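(* Let $H$ be a fixed graph. The property of being $H$-free (i.e. containing no, not necessarily induced, subgraph isomorphic to $H$) is testable in the VDF (Vertex-Distribution-Free) model if and only if $H$ has no isolated vertices.
   Context: All graphs are finite, simple and undirected. A graph property is a family of graphs closed under isomorphism. A vertex-weighted graph is a pair $(G,\mathcal{D})$ with $G$ a graph and $\mathcal{D}$ a probability distribution on $V(G)$ (weight $0$ is allowed). For graphs $G_1,G_2$ on the same vertex set $V$ and a distribution $\mathcal{D}$ on $V$, their distance with respect to $\mathcal{D}$ is $\sum_{\{x,y\}\in E(G_1)\triangle E(G_2)}\mathcal{D}(x)\mathcal{D}(y)$. $(G,\mathcal{D})$ is $\varepsilon$-far from a graph property $\mathcal{P}$ if for every $G'\in\mathcal{P}$ with $V(G')=V(G)$ the distance between $G$ and $G'$ with respect to $\mathcal{D}$ is at least $\varepsilon$. VDF model. The input is $(G,\mathcal{D})$, with $\mathcal{D}$ arbitrary and unknown to the algorithm, and a proximity parameter $\varepsilon\in(0,1)$. A randomized algorithm can access the input only by drawing independent random vertices of $G$ distributed according to $\mathcal{D}$ and by making edge queries "is $\{u,v\}$ an edge of $G$?", where $u,v$ are vertices it has sampled. It is not given $|V(G)|$. A tester for $\mathcal{P}$ is such an algorithm which, for every $\varepsilon\in(0,1)$ and every $(G,\mathcal{D})$, accepts with probability at least $2/3$ if $G\in\mathcal{P}$ and rejects with probability at least $2/3$ if $(G,\mathcal{D})$ is $\varepsilon$-far from $\mathcal{P}$. $\mathcal{P}$ is testable in the VDF model if there are a function $q:(0,1)\to\mathbb{N}$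 and a tester for $\mathcal{P}$ that always makes a total of at most $q(\varepsilon)$ vertex samples and edge queries, for every input $(G,\mathcal{D})$ and every $\varepsilon$ (so $q$ does not depend on $G$ or $\mathcal{D}$).
   Formalization: The graph H is assumed not to be the single-vertex graph; for that H no input graph (which is nonempty, carrying a probability distribution) is H-free, so always rejecting is a tester although H has an isolated vertex. *)

theory Defs
  imports "HOL-Probability.Probability_Mass_Function"
begin

section \<open>Finite simple graphs\<close>

type_synonym 'a graph = "'a set \<times> 'a set set"

abbreviation verts :: "'a graph \<Rightarrow> 'a set" where "verts \<equiv> fst"
abbreviation edges :: "'a graph \<Rightarrow> 'a set set" where "edges \<equiv> snd"

definition simple_graph :: "'a graph \<Rightarrow> bool" where
  "simple_graph G \<longleftrightarrow> finite (verts G) \<and> (\<forall>e\<in>edges G. e \<subseteq> verts G \<and> card e = 2)"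

definition isolated :: "'a graph \<Rightarrow> 'a \<Rightarrow> bool" where
  "isolated G v \<longleftrightarrow> v \<in> verts G \<and> (\<forall>e\<in>edges G. v \<notin> e)"

definition isomorphic :: "'a graph \<Rightarrow> 'b graph \<Rightarrow> bool" where
  "isomorphic G H \<longleftrightarrow>
     (\<exists>f. bij_betw f (verts G) (verts H) \<and> edges H = (\<lambda>e. f ` e) ` edges G)"

definition subgraph :: "'a graph \<Rightarrow> 'a graph \<Rightarrow> bool" where
  "subgraph S G \<longleftrightarrow> simple_graph S \<and> verts S \<subseteq> verts G \<and> edges S \<subseteq> edges G"

text \<open>
  Vertices of input graphs are labelled by natural numbers; the label set is an arbitrary
  finite set of naturals, and every finite graph is isomorphic to a graph of this kind.
\<close>

definition graph_property :: "nat graph set \<Rightarrow> bool" where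
  "graph_property P \<longleftrightarrow>
     (\<forall>G\<in>P. simple_graph G) \<and>
     (\<forall>G\<in>P. \<forall>G'. simple_graph G' \<and> isomorphic G G' \<longrightarrow> G' \<in> P)"

definition H_free :: "'a graph \<Rightarrow> nat graph set" where
  "H_free H = {G. simple_graph G \<and> \<not> (\<exists>S. subgraph S G \<and> isomorphic S H)}"


section \<open>Vertex-weighted graphs and distance\<close>

definition vertex_weighted :: "nat graph \<Rightarrow> nat pmf \<Rightarrow> bool" where
  "vertex_weighted G D \<longleftrightarrow> simple_graph G \<and> set_pmf D \<subseteq> verts G"

definition graph_dist :: "nat pmf \<Rightarrow> nat graph \<Rightarrow> nat graph \<Rightarrow> real" where
  "graph_dist D G1 G2 = (\<Sum>e\<in>sym_diff (edges G1) (edges G2). \<Prod>x\<in>e. pmf D x)"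

definition far :: "real \<Rightarrow> nat graph \<Rightarrow> nat pmf \<Rightarrow> nat graph set \<Rightarrow> bool" where
  "far \<epsilon> G D P \<longleftrightarrow> (\<forall>G'\<in>P. verts G' = verts G \<longrightarrow> graph_dist D G G' \<ge> \<epsilon>)"


section \<open>The VDF model\<close>

text \<open>
  A randomized algorithm is a decision tree: \<open>Coin\<close> is internal randomness, \<open>Sample\<close> draws a
  fresh vertex from the unknown distribution and continues depending on its label, and \<open>Query u v\<close>
  asks whether there is an edge between \<open>u\<close> and \<open>v\<close>. The branch taken records the whole history.
\<close>

datatype algorithm =
    Output bool
  | Coin "algorithm pmf"
  | Sample "nat \<Rightarrow> algorithm"
  | Query nat nat "bool \<Rightarrow> algorithm"

text \<open>\<open>legal S A\<close>: having already sampled the vertices in \<open>S\<close>, the algorithm \<open>A\<close> queries only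
  pairs of vertices that it has sampled.\<close>

inductive legal :: "nat set \<Rightarrow> algorithm \<Rightarrow> bool" where
  "legal S (Output b)"
| "(\<And>A. A \<in> set_pmf p \<Longrightarrow> legal S A) \<Longrightarrow> legal S (Coin p)"
| "(\<And>v. legal (insert v S) (k v)) \<Longrightarrow> legal S (Sample k)"
| "u \<in> S \<Longrightarrow> v \<in> S \<Longrightarrow> (\<And>b. legal S (k b)) \<Longrightarrow> legal S (Query u v k)"

text \<open>The joint distribution of the verdict (\<open>True\<close> means accept) and of the total number of
  samples and queries made.\<close>

primrec run :: "nat graph \<Rightarrow> nat pmf \<Rightarrow> algorithm \<Rightarrow> (bool \<times> nat) pmf" where
  "run G D (Output b) = return_pmf (b, 0)"
| "run G D (Coin p) = join_pmf (map_pmf (run G D) p)"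
| "run G D (Sample k) = bind_pmf D (\<lambda>v. map_pmf (apsnd Suc) (run G D (k v)))"
| "run G D (Query u v k) = map_pmf (apsnd Suc) (run G D (k ({u, v} \<in> edges G)))"

definition vdf_tester :: "(real \<Rightarrow> algorithm) \<Rightarrow> nat graph set \<Rightarrow> bool" where
  "vdf_tester T P \<longleftrightarrow>
     (\<forall>\<epsilon>. 0 < \<epsilon> \<and> \<epsilon> < 1 \<longrightarrow>
        legal {} (T \<epsilon>) \<and>
        (\<forall>G D. vertex_weighted G D \<longrightarrow>
           (G \<in> P \<longrightarrow> pmf (map_pmf fst (run G D (T \<epsilon>))) True \<ge> 2/3) \<and>
           (far \<epsilon> G D P \<longrightarrow> pmf (map_pmf fst (run G D (T \<epsilon>))) False \<ge> 2/3)))"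

definition vdf_testable :: "nat graph set \<Rightarrow> bool" where
  "vdf_testable P \<longleftrightarrow>
     (\<exists>(q :: real \<Rightarrow> nat) T. vdf_tester T P \<and>
        (\<forall>\<epsilon> G D. 0 < \<epsilon> \<and> \<epsilon> < 1 \<and> vertex_weighted G D \<longrightarrow>
           (\<forall>(b, n)\<in>set_pmf (run G D (T \<epsilon>)). n \<le> q \<epsilon>)))"


section \<open>Sanity checks\<close>

lemma isomorphic_sym:
  assumes "simple_graph G" "isomorphic G H"
  shows "isomorphic H G"
proof -
  obtain f where f: "bij_betw f (verts G) (verts H)" "edges H = (\<lambda>e. f ` e) ` edges G"
    using assms(2) unfolding isomorphic_def by blast
  let ?g = "inv_into (verts G) f"
  have "?g ` f ` e = e" if "e \<in> edges G" for e
    using that assms(1) f(1) unfolding simple_graph_def bij_betw_def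
    by (metis inv_into_image_cancel)
  then have "edges G = (\<lambda>e. ?g ` e) ` edges H"
    unfolding f(2) image_image by simp
  then show ?thesis
    using bij_betw_inv_into[OF f(1)] unfolding isomorphic_def by blast
qed

lemma isomorphic_trans:
  assumes "isomorphic F G" "isomorphic G H"
  shows "isomorphic F H"
proof -
  obtain g where g: "bij_betw g (verts F) (verts G)" "edges G = (\<lambda>e. g ` e) ` edges F"
    using assms(1) unfolding isomorphic_def by blast
  obtain h where h: "bij_betw h (verts G) (verts H)" "edges H = (\<lambda>e. h ` e) ` edges G"
    using assms(2) unfolding isomorphic_def by blast
  have "edges H = (\<lambda>e. (h \<circ> g) ` e) ` edges F"
    by (simp only: h(2) g(2) image_image comp_def)
  then show ?thesis
    using bij_betw_trans[OF g(1) h(1)] unfolding isomorphic_def by blast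
qed

lemma graph_property_H_free: "graph_property (H_free H)"
proof -
  have "G' \<in> H_free H"
    if G: "G \<in> H_free H" and G': "simple_graph G'" and iso: "isomorphic G G'" for G G'
  proof (rule ccontr)
    assume "G' \<notin> H_free H"
    then obtain S where S: "subgraph S G'" "isomorphic S H"
      using G' unfolding H_free_def by blast
    have "simple_graph G"
      using G unfolding H_free_def by simp
    then have "isomorphic G' G"
      using iso by (rule isomorphic_sym)
    then obtain f where f: "bij_betw f (verts G') (verts G)" "edges G = (\<lambda>e. f ` e) ` edges G'"
      unfolding isomorphic_def by blast
    let ?S = "(f ` verts S, (\<lambda>e. f ` e) ` edges S)"
    have inj: "inj_on f (verts S)"
      using f(1) S(1) unfolding bij_betw_def subgraph_def by (blast intro: inj_on_subset)
    have card: "card (f ` e) = card e" if "e \<in> edges S" for e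
      using that S(1) inj unfolding subgraph_def simple_graph_def
      by (meson card_image inj_on_subset)
    have "simple_graph ?S"
      using S(1) card unfolding subgraph_def simple_graph_def by auto
    moreover have "f ` verts S \<subseteq> verts G"
      using S(1) f(1) unfolding subgraph_def bij_betw_def by blast
    moreover have "(\<lambda>e. f ` e) ` edges S \<subseteq> edges G"
      using S(1) f(2) unfolding subgraph_def by blast
    ultimately have sub: "subgraph ?S G"
      unfolding subgraph_def by simp
    have "isomorphic S ?S"
      using inj unfolding isomorphic_def bij_betw_def by auto
    then have "isomorphic ?S S"
      using isomorphic_sym S(1) unfolding subgraph_def by blast
    then have "isomorphic ?S H"
      using S(2) by (rule isomorphic_trans)
    with sub G show False
      unfolding H_free_def by blast
  qed
  then show ?thesis
    unfolding graph_property_def H_free_def by blast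
qed

text \<open>
  A probability distribution on the vertices forces an input graph to be nonempty, so no input
  graph is free of the one-vertex graph, and the algorithm that always rejects is a tester.
  Thus the one-vertex graph, whose vertex is isolated, has to be excluded when characterizing the
  testability of \<open>H_free H\<close> by the absence of isolated vertices in \<open>H\<close>.
\<close>

lemma vdf_testable_one_vertex_free:
  assumes "simple_graph H" "card (verts H) = 1"
  shows "vdf_testable (H_free H)"
proof -
  obtain h where h: "verts H = {h}"
    using assms(2) card_1_singletonE by blast
  have no_edges: "edges H = {}"
  proof (rule ccontr)
    assume "edges H \<noteq> {}"
    then obtain e where "e \<subseteq> {h}" "card e = 2"
      using assms(1) h unfolding simple_graph_def by auto
    then show False
      using card_mono[of "{h}" e] by simp
  qed
  have "G \<notin> H_free H" if GD: "vertex_weighted G D" for G D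
  proof -
    obtain v where v: "v \<in> verts G"
      using GD set_pmf_not_empty[of D] unfolding vertex_weighted_def by blast
    have "subgraph ({v}, {}) G"
      using v unfolding subgraph_def simple_graph_def by simp
    moreover have "isomorphic ({v}, {}) H"
      unfolding isomorphic_def
      by (rule exI[of _ "\<lambda>_. h"]) (simp add: h no_edges bij_betw_def)
    ultimately show ?thesis
      unfolding H_free_def by blast
  qed
  then have "vdf_tester (\<lambda>_. Output False) (H_free H)"
    unfolding vdf_tester_def by (auto intro: legal.intros)
  then show ?thesis
    unfolding vdf_testable_def by (intro exI[of _ "\<lambda>_. 0"] exI[of _ "\<lambda>_. Output False"]) auto
qed

end

theory Submission
  imports Defs
begin

text \<open>
  The tester repeatedly samples \<open>card (verts H)\<close> vertices and rejects when they span a copy of \<open>H\<close>.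
  Its soundness is a removal lemma for vertex-weighted graphs, proved by energy increment.
  Copies of \<open>H\<close> must be injective, so vertices that are heavy within their class of the partition
  are an obstacle: homomorphisms into a single heavy vertex carry much weight. Heavy vertices are
  therefore split off as singleton classes, and the total weight of singleton classes is added to
  the energy as a second bounded monotone potential. After deleting edges at classes of small weight,
  at classes still dominated by heavy vertices, and between sparse or irregular pairs, a surviving copy
  of \<open>H\<close> yields many copies by greedy embedding; each of its vertices lies in a usable class only
  because \<open>H\<close> has no isolated vertex. Conversely, a vertex of weight zero can serve as the isolated
  vertex of \<open>H\<close> without ever being sampled.
\<close>

section \<open>Conditional averages\<close>

text \<open>Only a lower bound on copies is needed, so regularity is one-sided: a pair of density at
  least \<open>d\<close> is bad only if it contains large subsets of density at most
  \<open>d / 2\<close>. Several vertices of \<open>H\<close> may land in one class. The greedy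
  embedding then has to remove each chosen vertex from the remaining candidate sets, which is cheap
  for a vertex that is light in its class and ruinous for one that dominates it. A singleton class
  is exempt, because an injective copy visits it only once; this is why turning heavy vertices into
  singletons removes the obstacle instead of moving it. The bound must not depend on the graph, and
  this fixes the order of the constants: \<open>d\<close> from \<epsilon>, \<rho> from
  \<open>d\<close> and \<open>h\<close>, \<beta> and \<eta> from \<rho>; these determine the gain of
  a refinement, hence the number \<open>K\<close> of refinements and the bound \<open>N\<close> on
  the size of the generating family. The threshold \<theta> for small classes has to come after
  \<open>N\<close>, since up to \<open>2 ^ N\<close> classes may fall below it.\<close>

definition cavg :: "'a set \<Rightarrow> ('a \<Rightarrow> real) \<Rightarrow> ('a \<Rightarrow> 'k) \<Rightarrow> ('a \<Rightarrow> real) \<Rightarrow> 'a \<Rightarrow> real" where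
  "cavg \<Omega> \<mu> \<kappa> f x =
     (\<Sum>y | y \<in> \<Omega> \<and> \<kappa> y = \<kappa> x. \<mu> y * f y) / (\<Sum>y | y \<in> \<Omega> \<and> \<kappa> y = \<kappa> x. \<mu> y)"

lemma cavg_cong: "\<kappa> x = \<kappa> y \<Longrightarrow> cavg \<Omega> \<mu> \<kappa> f x = cavg \<Omega> \<mu> \<kappa> f y"
  by (simp add: cavg_def)

text \<open>On each fibre of \<kappa> both sides are the common value of \<open>g\<close> times the
  \<open>f\<close>-weight of the fibre: averaging is the orthogonal projection onto functions
  constant on the classes. A partition is encoded by a labelling, so that refinement is an
  implication between equalities of labels.\<close>

lemma sum_cavg:
  fixes \<mu> :: "'a \<Rightarrow> real"
  assumes fin: "finite \<Omega>" and nn: "\<And>x. x \<in> \<Omega> \<Longrightarrow> 0 \<le> \<mu> x"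
    and g: "\<And>x y. x \<in> \<Omega> \<Longrightarrow> y \<in> \<Omega> \<Longrightarrow> \<kappa> x = \<kappa> y \<Longrightarrow> g x = g y"
  shows "(\<Sum>x\<in>\<Omega>. \<mu> x * cavg \<Omega> \<mu> \<kappa> f x * g x) = (\<Sum>x\<in>\<Omega>. \<mu> x * f x * g x)"
proof -
  have "(\<Sum>x | x \<in> \<Omega> \<and> \<kappa> x = k. \<mu> x * cavg \<Omega> \<mu> \<kappa> f x * g x)
      = (\<Sum>x | x \<in> \<Omega> \<and> \<kappa> x = k. \<mu> x * f x * g x)" if k: "k \<in> \<kappa> ` \<Omega>" for k
  proof -
    obtain x0 where x0: "x0 \<in> \<Omega>" "k = \<kappa> x0" using k by blast
    let ?B = "{x. x \<in> \<Omega> \<and> \<kappa> x = k}"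
    have finB: "finite ?B" using fin by simp
    have gB: "g x = g x0" if "x \<in> ?B" for x
      using g[of x x0] that x0 by simp
    have "(\<Sum>x\<in>?B. \<mu> x * cavg \<Omega> \<mu> \<kappa> f x * g x)
        = (\<Sum>x\<in>?B. \<mu> x * (cavg \<Omega> \<mu> \<kappa> f x0 * g x0))"
    proof (rule sum.cong)
      fix x assume "x \<in> ?B"
      then have "g x = g x0" "cavg \<Omega> \<mu> \<kappa> f x = cavg \<Omega> \<mu> \<kappa> f x0"
        using x0 gB[of x] by (simp_all add: cavg_cong[of _ x x0])
      then show "\<mu> x * cavg \<Omega> \<mu> \<kappa> f x * g x = \<mu> x * (cavg \<Omega> \<mu> \<kappa> f x0 * g x0)" by simp
    qed simp
    also have "\<dots> = sum \<mu> ?B * cavg \<Omega> \<mu> \<kappa> f x0 * g x0"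
      by (simp add: sum_distrib_right mult.assoc)
    also have "\<dots> = (\<Sum>x\<in>?B. \<mu> x * f x) * g x0"
    \<comment> \<open>On a fibre of weight zero the average is 0 through division by zero; the
      identity survives because every weight in the fibre vanishes.\<close>
    proof (cases "sum \<mu> ?B = 0")
      case True
      then have "\<forall>x\<in>?B. \<mu> x = 0"
        using sum_nonneg_eq_0_iff[OF finB, of \<mu>] nn by simp
      then show ?thesis by (simp add: True)
    next
      case False
      then show ?thesis by (simp add: cavg_def x0(2))
    qed
    also have "\<dots> = (\<Sum>x\<in>?B. \<mu> x * f x * g x)"
      unfolding sum_distrib_right using gB by (intro sum.cong) simp_all
    finally show ?thesis .
  qed
  then show ?thesis
    unfolding sum.image_gen[OF fin, of _ \<kappa>] by (rule sum.cong[OF refl])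
qed

lemma cavg_bounds:
  assumes "\<And>x. x \<in> \<Omega> \<Longrightarrow> 0 \<le> \<mu> x" and "\<And>x. x \<in> \<Omega> \<Longrightarrow> 0 \<le> f x \<and> f x \<le> 1"
  shows "0 \<le> cavg \<Omega> \<mu> \<kappa> f x" and "cavg \<Omega> \<mu> \<kappa> f x \<le> 1"
proof -
  let ?B = "{y. y \<in> \<Omega> \<and> \<kappa> y = \<kappa> x}"
  have 0: "0 \<le> sum \<mu> ?B" "0 \<le> (\<Sum>y\<in>?B. \<mu> y * f y)"
    using assms by (auto intro!: sum_nonneg)
  have 1: "(\<Sum>y\<in>?B. \<mu> y * f y) \<le> sum \<mu> ?B"
    using assms by (intro sum_mono) (auto intro!: mult_left_le)
  show "0 \<le> cavg \<Omega> \<mu> \<kappa> f x" using 0 by (simp add: cavg_def)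
  show "cavg \<Omega> \<mu> \<kappa> f x \<le> 1"
    using 0 1 unfolding cavg_def by (intro divide_le_eq_1[THEN iffD2]) linarith
qed

text \<open>Squared norm of the projection of \<open>f\<close>, the usual potential of a regularity
  argument.\<close>

definition energy :: "'a set \<Rightarrow> ('a \<Rightarrow> real) \<Rightarrow> ('a \<Rightarrow> 'k) \<Rightarrow> ('a \<Rightarrow> real) \<Rightarrow> real" where
  "energy \<Omega> \<mu> \<kappa> f = (\<Sum>x\<in>\<Omega>. \<mu> x * (cavg \<Omega> \<mu> \<kappa> f x)\<^sup>2)"

lemma energy_nonneg:
  assumes "\<And>x. x \<in> \<Omega> \<Longrightarrow> 0 \<le> \<mu> x"
  shows "0 \<le> energy \<Omega> \<mu> \<kappa> f"
  using assms unfolding energy_def by (auto intro!: sum_nonneg)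

lemma energy_le:
  assumes "\<And>x. x \<in> \<Omega> \<Longrightarrow> 0 \<le> \<mu> x" and "\<And>x. x \<in> \<Omega> \<Longrightarrow> 0 \<le> f x \<and> f x \<le> 1"
  shows "energy \<Omega> \<mu> \<kappa> f \<le> sum \<mu> \<Omega>"
  unfolding energy_def
  using assms(1) by (intro sum_mono mult_left_le power_le_one cavg_bounds[OF assms])

text \<open>Expanding a square around the difference of the two conditional averages replaces the
  Cauchy--Schwarz argument of the usual energy increment: \<open>g\<close> is a test function witnessing
  that \<open>\<kappa>\<close> does not resolve \<open>f\<close>.\<close>

lemma energy_gain:
  assumes fin: "finite \<Omega>" and nn: "\<And>x. x \<in> \<Omega> \<Longrightarrow> 0 \<le> \<mu> x"
    and refines: "\<And>x y. x \<in> \<Omega> \<Longrightarrow> y \<in> \<Omega> \<Longrightarrow> \<kappa>' x = \<kappa>' y \<Longrightarrow> \<kappa> x = \<kappa> y"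
    and g: "\<And>x y. x \<in> \<Omega> \<Longrightarrow> y \<in> \<Omega> \<Longrightarrow> \<kappa>' x = \<kappa>' y \<Longrightarrow> g x = g y"
  shows "energy \<Omega> \<mu> \<kappa>' f \<ge> energy \<Omega> \<mu> \<kappa> f
     + 2 * (\<Sum>x\<in>\<Omega>. \<mu> x * (cavg \<Omega> \<mu> \<kappa> f x - f x) * g x) - (\<Sum>x\<in>\<Omega>. \<mu> x * (g x)\<^sup>2)"
proof -
  let ?u = "cavg \<Omega> \<mu> \<kappa> f" and ?v = "cavg \<Omega> \<mu> \<kappa>' f"
  \<comment> \<open>Pythagoras: the finer and the coarser average have the same product with
    \<open>?u\<close>, so the mixed term equals the energy of \<kappa>.\<close>
  have "(\<Sum>x\<in>\<Omega>. \<mu> x * ?v x * ?u x) = (\<Sum>x\<in>\<Omega>. \<mu> x * f x * ?u x)"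
    by (rule sum_cavg[OF fin nn]) (auto intro: cavg_cong refines)
  also have "\<dots> = (\<Sum>x\<in>\<Omega>. \<mu> x * ?u x * ?u x)"
    by (rule sum_cavg[OF fin nn, symmetric]) (auto intro: cavg_cong)
  finally have vu: "(\<Sum>x\<in>\<Omega>. \<mu> x * ?v x * ?u x) = (\<Sum>x\<in>\<Omega>. \<mu> x * (?u x)\<^sup>2)"
    by (simp add: power2_eq_square mult.assoc)
  have vg: "(\<Sum>x\<in>\<Omega>. \<mu> x * ?v x * g x) = (\<Sum>x\<in>\<Omega>. \<mu> x * f x * g x)"
    by (rule sum_cavg[OF fin nn g])
  have "0 \<le> (\<Sum>x\<in>\<Omega>. \<mu> x * (?v x - ?u x + g x)\<^sup>2)"
    using nn by (auto intro!: sum_nonneg)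
  also have "\<dots> = (\<Sum>x\<in>\<Omega>. \<mu> x * (?v x)\<^sup>2 + \<mu> x * (?u x)\<^sup>2 + \<mu> x * (g x)\<^sup>2
      - 2 * (\<mu> x * ?v x * ?u x) + 2 * (\<mu> x * ?v x * g x) - 2 * (\<mu> x * ?u x * g x))"
    by (intro sum.cong) (auto simp: power2_eq_square algebra_simps)
  also have "\<dots> = (\<Sum>x\<in>\<Omega>. \<mu> x * (?v x)\<^sup>2) - (\<Sum>x\<in>\<Omega>. \<mu> x * (?u x)\<^sup>2) + (\<Sum>x\<in>\<Omega>. \<mu> x * (g x)\<^sup>2)
      + 2 * (\<Sum>x\<in>\<Omega>. \<mu> x * f x * g x) - 2 * (\<Sum>x\<in>\<Omega>. \<mu> x * ?u x * g x)"
    by (simp add: sum.distrib sum_subtractf sum_distrib_left[symmetric] vu vg)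
  finally show ?thesis
    by (simp add: energy_def sum_subtractf algebra_simps)
qed

section \<open>Partitions generated by families of sets\<close>

locale weighted_graph =
  fixes V :: "'a set" and w :: "'a \<Rightarrow> real" and A :: "'a \<Rightarrow> 'a \<Rightarrow> bool"
  assumes finV: "finite V" and w_nonneg: "0 \<le> w x" and sum_w: "sum w V = 1"
begin

text \<open>A partition is represented by a family generating it: its classes are the atoms of the
  generated algebra on \<open>V\<close>. Refining means adding sets, a common refinement is a union
  of families, and the number of classes is controlled by the size of the family.\<close>

definition vtype :: "'a set set \<Rightarrow> 'a \<Rightarrow> 'a set set" where
  "vtype F x = {S \<in> F. x \<in> S}"

definition cls :: "'a set set \<Rightarrow> 'a \<Rightarrow> 'a set" where
  "cls F x = {y \<in> V. vtype F y = vtype F x}"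

definition edge_mass :: "'a set \<Rightarrow> 'a set \<Rightarrow> real" where
  "edge_mass X Y = (\<Sum>(x, y)\<in>X \<times> Y. w x * w y * of_bool (A x y))"

definition density :: "'a set \<Rightarrow> 'a set \<Rightarrow> real" where
  "density X Y = edge_mass X Y / (sum w X * sum w Y)"

definition sparse_spot :: "real \<Rightarrow> real \<Rightarrow> 'a set \<Rightarrow> 'a set \<Rightarrow> 'a set \<Rightarrow> 'a set \<Rightarrow> bool" where
  "sparse_spot d \<beta> P Q X Y \<longleftrightarrow> X \<subseteq> P \<and> Y \<subseteq> Q \<and> \<beta> * sum w P \<le> sum w X \<and> \<beta> * sum w Q \<le> sum w Y \<and>
     edge_mass X Y \<le> d / 2 * (sum w X * sum w Y)"

definition irregular :: "real \<Rightarrow> real \<Rightarrow> 'a set \<Rightarrow> 'a set \<Rightarrow> bool" where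
  "irregular d \<beta> P Q \<longleftrightarrow> d \<le> density P Q \<and> (\<exists>X Y. sparse_spot d \<beta> P Q X Y)"

text \<open>The clause for singletons encodes their exemption: the only vertex of a singleton class
  carries all its weight, yet such a class never counts as clumpy.\<close>

definition light_part :: "real \<Rightarrow> 'a set \<Rightarrow> 'a set" where
  "light_part \<eta> P = {x \<in> P. is_singleton P \<or> w x \<le> \<eta> * sum w P}"

definition clumpy :: "real \<Rightarrow> 'a set \<Rightarrow> bool" where
  "clumpy \<eta> P \<longleftrightarrow> sum w (light_part \<eta> P) < sum w P / 2"

definition irregular_mass :: "real \<Rightarrow> real \<Rightarrow> 'a set set \<Rightarrow> real" where
  "irregular_mass d \<beta> F =
     (\<Sum>(x, y) | (x, y) \<in> V \<times> V \<and> irregular d \<beta> (cls F x) (cls F y). w x * w y)"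

definition clumpy_mass :: "real \<Rightarrow> 'a set set \<Rightarrow> real" where
  "clumpy_mass \<eta> F = (\<Sum>x | x \<in> V \<and> clumpy \<eta> (cls F x). w x)"

text \<open>The square includes pairs inside one class, so edges within a class are treated as the
  pair of that class with itself and need not be discarded.\<close>

definition pair_energy :: "'a set set \<Rightarrow> real" where
  "pair_energy F = energy (V \<times> V) (\<lambda>(x, y). w x * w y) (map_prod (vtype F) (vtype F))
     (\<lambda>(x, y). of_bool (A x y))"

definition singleton_mass :: "'a set set \<Rightarrow> real" where
  "singleton_mass F = (\<Sum>x | x \<in> V \<and> cls F x = {x}. w x)"

section \<open>Classes of a generated partition; bounds and monotonicity of the two
  potentials\<close>

lemma vtype_mono: "vtype F' x = vtype F' y \<Longrightarrow> F \<subseteq> F' \<Longrightarrow> vtype F x = vtype F y"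
  unfolding vtype_def by blast

lemma vtype_mem: "vtype F x = vtype F y \<Longrightarrow> S \<in> F \<Longrightarrow> x \<in> S \<longleftrightarrow> y \<in> S"
  unfolding vtype_def by blast

lemma cls_self: "x \<in> V \<Longrightarrow> x \<in> cls F x"
  by (simp add: cls_def)

lemma cls_subset: "cls F x \<subseteq> V"
  by (auto simp: cls_def)

lemma finite_cls: "finite (cls F x)"
  using finV finite_subset[OF cls_subset] by blast

lemma cls_eq: "vtype F x = vtype F y \<Longrightarrow> cls F x = cls F y"
  by (simp add: cls_def)

lemma cls_mem: "y \<in> cls F x \<Longrightarrow> cls F y = cls F x"
  by (auto simp: cls_def)

lemma fiber_cls: "P \<in> cls F ` V \<Longrightarrow> {x \<in> V. cls F x = P} = P"
  by (auto simp: cls_def)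

lemma card_cls:
  assumes "finite F"
  shows "card (cls F ` V) \<le> 2 ^ card F"
proof -
  have "cls F ` V \<subseteq> (\<lambda>T. {y \<in> V. vtype F y = T}) ` Pow F"
    by (auto simp: cls_def vtype_def image_iff)
  then have "card (cls F ` V) \<le> card (Pow F)"
    using assms by (meson card_image_le card_mono finite_Pow_iff finite_imageI le_trans)
  then show ?thesis using assms by (simp add: card_Pow)
qed

lemma sum_prod_w: "(\<Sum>(x, y)\<in>X \<times> Y. w x * w y) = sum w X * sum w Y"
  by (simp add: sum_product sum.cartesian_product)

lemma cavg_vtype:
  "cavg (V \<times> V) (\<lambda>(x, y). w x * w y) (map_prod (vtype F) (vtype F)) (\<lambda>(x, y). of_bool (A x y)) (x, y)
   = density (cls F x) (cls F y)"
proof -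
  have "{p. p \<in> V \<times> V \<and> map_prod (vtype F) (vtype F) p = map_prod (vtype F) (vtype F) (x, y)}
      = cls F x \<times> cls F y"
    by (auto simp: cls_def)
  then show ?thesis
    unfolding cavg_def density_def edge_mass_def
    by (simp add: sum_prod_w[symmetric] case_prod_unfold)
qed

lemma pair_energy_bounds: "0 \<le> pair_energy F" "pair_energy F \<le> 1"
proof -
  show "0 \<le> pair_energy F"
    unfolding pair_energy_def by (rule energy_nonneg) (auto simp: w_nonneg)
  have "pair_energy F \<le> sum (\<lambda>(x, y). w x * w y) (V \<times> V)"
    unfolding pair_energy_def by (rule energy_le) (auto simp: w_nonneg)
  then show "pair_energy F \<le> 1" by (simp add: sum_prod_w sum_w)
qed

lemma singleton_mass_bounds: "0 \<le> singleton_mass F" "singleton_mass F \<le> 1"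
proof -
  show "0 \<le> singleton_mass F"
    unfolding singleton_mass_def by (auto intro: sum_nonneg simp: w_nonneg)
  have "singleton_mass F \<le> sum w V"
    unfolding singleton_mass_def using finV by (intro sum_mono2) (auto simp: w_nonneg)
  then show "singleton_mass F \<le> 1" by (simp add: sum_w)
qed

lemma pair_energy_mono:
  assumes "F \<subseteq> F'"
  shows "pair_energy F \<le> pair_energy F'"
proof -
  \<comment> \<open>\<open>energy_gain\<close> with the zero test function.\<close>
  have "pair_energy F' \<ge> pair_energy F
     + 2 * (\<Sum>x\<in>V \<times> V. (case x of (x, y) \<Rightarrow> w x * w y) * (cavg (V \<times> V) (\<lambda>(x, y). w x * w y) (map_prod (vtype F) (vtype F))
     (\<lambda>(x, y). of_bool (A x y)) x - (case x of (x, y) \<Rightarrow> of_bool (A x y))) * 0)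
     - (\<Sum>x\<in>V \<times> V. (case x of (x, y) \<Rightarrow> w x * w y) * 0\<^sup>2)"
    unfolding pair_energy_def using finV
    by (intro energy_gain) (auto simp: w_nonneg intro!: vtype_mono[OF _ assms])
  then show ?thesis by simp
qed

lemma singleton_mass_mono:
  assumes "F \<subseteq> F'"
  shows "singleton_mass F \<le> singleton_mass F'"
proof -
  have "cls F' x \<subseteq> cls F x" for x
    by (auto simp: cls_def intro!: vtype_mono[OF _ assms])
  then have "{x. x \<in> V \<and> cls F x = {x}} \<subseteq> {x. x \<in> V \<and> cls F' x = {x}}"
    using cls_self by blast
  then show ?thesis
    unfolding singleton_mass_def using finV by (intro sum_mono2) (auto simp: w_nonneg)
qed

text \<open>The test function is \<open>d / 2\<close> on the union \<open>Z\<close> of sparse spots,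
  one for each irregular pair. On \<open>Z\<close> the average is at least \<open>d\<close> while
  the true density is at most \<open>d / 2\<close>, so the linear term of \<open>energy_gain\<close>
  contributes at least \<open>d\<^sup>2 / 2\<close> times the weight of \<open>Z\<close> and the
  quadratic term costs half of that. Each spot fills at least the fraction
  \<open>\<beta>\<^sup>2\<close> of its pair.\<close>

lemma refine_energy:
  assumes F: "finite F" and d: "0 < d" and \<beta>: "0 < \<beta>"
  obtains F' where "finite F'" "card F' \<le> 2 * 4 ^ card F" 
    "pair_energy (F \<union> F') \<ge> pair_energy F + d\<^sup>2 / 4 * \<beta>\<^sup>2 * irregular_mass d \<beta> F"
proof -
  have "\<exists>X Y. irregular d \<beta> P Q \<longrightarrow> sparse_spot d \<beta> P Q X Y" for P Q
    unfolding irregular_def by blast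
  then obtain X Y where XY: "\<And>P Q. irregular d \<beta> P Q \<Longrightarrow> sparse_spot d \<beta> P Q (X P Q) (Y P Q)"
    by metis
  let ?C = "cls F ` V"
  \<comment> \<open>Pairs that are not irregular contribute arbitrary sets, which only refine
    further; this keeps the count at two sets per pair of classes, and there are at most
    \<open>4 ^ card F\<close> such pairs.\<close>
  define F' where "F' = (\<lambda>(P, Q). X P Q) ` (?C \<times> ?C) \<union> (\<lambda>(P, Q). Y P Q) ` (?C \<times> ?C)"
  have finF': "finite F'" unfolding F'_def using finV by simp
  have "card F' \<le> card (?C \<times> ?C) + card (?C \<times> ?C)"
    unfolding F'_def using finV
    by (intro order_trans[OF card_Un_le] add_mono card_image_le) auto
  also have "\<dots> = 2 * (card ?C * card ?C)" by (simp add: card_cartesian_product)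
  also have "\<dots> \<le> 2 * (2 ^ card F * 2 ^ card F)"
    using card_cls[OF F] by (intro mult_le_mono) auto
  also have "\<dots> = 2 * 4 ^ card F" by (simp flip: power_mult_distrib)
  finally have cardF': "card F' \<le> 2 * 4 ^ card F" .
  let ?B = "{p \<in> V \<times> V. irregular d \<beta> (cls F (fst p)) (cls F (snd p))}"
  define Z where "Z = {p \<in> ?B. fst p \<in> X (cls F (fst p)) (cls F (snd p))
     \<and> snd p \<in> Y (cls F (fst p)) (cls F (snd p))}"
  let ?\<mu> = "\<lambda>(x, y). w x * w y" and ?f = "\<lambda>(x, y). of_bool (A x y) :: real"
  let ?c = "\<lambda>p. (cls F (fst p), cls F (snd p))"
  have fB: "finite ?B" and fZ: "finite Z" using finV unfolding Z_def by simp_all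
  \<comment> \<open>Grouping by the pair of classes reduces both estimates below to a single
    rectangle inside a pair \<open>P \<times> Q\<close>.\<close>
  have fibB: "{p \<in> ?B. ?c p = (P, Q)} = (if irregular d \<beta> P Q then P \<times> Q else {})"
    and fibZ: "{p \<in> Z. ?c p = (P, Q)} = (if irregular d \<beta> P Q then X P Q \<times> Y P Q else {})"
    if "P \<in> ?C" "Q \<in> ?C" for P Q
  proof -
    show 1: "{p \<in> ?B. ?c p = (P, Q)} = (if irregular d \<beta> P Q then P \<times> Q else {})"
      using fiber_cls[OF that(1)] fiber_cls[OF that(2)] by (auto 0 3)
    have "{p \<in> Z. ?c p = (P, Q)} = {p \<in> {p \<in> ?B. ?c p = (P, Q)}. fst p \<in> X P Q \<and> snd p \<in> Y P Q}"
      unfolding Z_def by auto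
    also have "\<dots> = (if irregular d \<beta> P Q then X P Q \<times> Y P Q else {})"
      unfolding 1 using XY[of P Q] unfolding sparse_spot_def by auto
    finally show "{p \<in> Z. ?c p = (P, Q)} = (if irregular d \<beta> P Q then X P Q \<times> Y P Q else {})" .
  qed
  have grp: "(\<Sum>R\<in>?C \<times> ?C. sum h {p \<in> S. ?c p = R}) = sum h S" if "S \<subseteq> ?B" for S and h :: "'a \<times> 'a \<Rightarrow> real"
    using that finV finite_subset[OF that fB] by (intro sum.group) auto
  have ZB: "Z \<subseteq> ?B" unfolding Z_def by blast
  have sumZ: "sum (\<lambda>p. ?\<mu> p * ?f p) Z \<le> d / 2 * sum ?\<mu> Z"
  proof -
    have "sum (\<lambda>p. ?\<mu> p * ?f p) {p \<in> Z. ?c p = R} \<le> d / 2 * sum ?\<mu> {p \<in> Z. ?c p = R}"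
      if R: "R \<in> ?C \<times> ?C" for R
    proof -
      obtain P Q where PQ: "R = (P, Q)" "P \<in> ?C" "Q \<in> ?C" using R by auto
      show ?thesis
        using XY[of P Q] unfolding PQ(1) fibZ[OF PQ(2,3)] sparse_spot_def edge_mass_def sum_prod_w[symmetric]
        by (auto simp: case_prod_unfold)
    qed
    then show ?thesis
      unfolding grp[OF ZB, symmetric] sum_distrib_left[symmetric]
      by (simp only: sum_distrib_left) (rule sum_mono)
  qed
  have massZ: "\<beta>\<^sup>2 * sum ?\<mu> ?B \<le> sum ?\<mu> Z"
  proof -
    have "\<beta>\<^sup>2 * sum ?\<mu> {p \<in> ?B. ?c p = R} \<le> sum ?\<mu> {p \<in> Z. ?c p = R}"
      if R: "R \<in> ?C \<times> ?C" for R
    proof -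
      obtain P Q where PQ: "R = (P, Q)" "P \<in> ?C" "Q \<in> ?C" using R by auto
      show ?thesis
      proof (cases "irregular d \<beta> P Q")
        case True
        have "(\<beta> * sum w P) * (\<beta> * sum w Q) \<le> sum w (X P Q) * sum w (Y P Q)"
          using XY[OF True] \<beta> unfolding sparse_spot_def
          by (intro mult_mono) (auto intro!: mult_nonneg_nonneg sum_nonneg simp: w_nonneg)
        then show ?thesis
          unfolding PQ(1) fibZ[OF PQ(2,3)] fibB[OF PQ(2,3)]
          using True by (simp add: sum_prod_w power2_eq_square mult_ac)
      next
        case False
        then show ?thesis unfolding PQ(1) fibZ[OF PQ(2,3)] fibB[OF PQ(2,3)] by simp
      qed
    qed
    then show ?thesis
      unfolding grp[OF ZB, symmetric] grp[OF order_refl, symmetric]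
      by (simp only: sum_distrib_left) (rule sum_mono)
  qed
  define u where "u = cavg (V \<times> V) ?\<mu> (map_prod (vtype F) (vtype F)) ?f"
  have u: "d \<le> u p" if "p \<in> Z" for p
    using that unfolding u_def Z_def irregular_def by (cases p) (auto simp: cavg_vtype)
  define g where "g p = d / 2 * of_bool (p \<in> Z)" for p
  \<comment> \<open>The refined type of a vertex determines its old class and its membership in
    every chosen set, hence membership of a pair in \<open>Z\<close>.\<close>
  have gfac: "g p = g q" if pq: "p \<in> V \<times> V" "q \<in> V \<times> V"
    and t: "map_prod (vtype (F \<union> F')) (vtype (F \<union> F')) p = map_prod (vtype (F \<union> F')) (vtype (F \<union> F')) q" for p q
  proof -
    obtain x y x' y' where p: "p = (x, y)" "q = (x', y')" by (cases p, cases q)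
    have T: "vtype (F \<union> F') x = vtype (F \<union> F') x'" "vtype (F \<union> F') y = vtype (F \<union> F') y'"
      using t p by auto
    have c: "cls F x = cls F x'" "cls F y = cls F y'"
      using vtype_mono[OF T(1), of F] vtype_mono[OF T(2), of F] by (auto intro!: cls_eq)
    have "X (cls F x') (cls F y') \<in> F \<union> F'" "Y (cls F x') (cls F y') \<in> F \<union> F'"
      using pq p unfolding F'_def by (auto simp: image_iff)
    then show ?thesis
      using vtype_mem[OF T(1)] vtype_mem[OF T(2)] pq unfolding g_def Z_def p by (simp add: c)
  qed
  have ZV: "Z \<subseteq> V \<times> V" unfolding Z_def by auto
  have sg: "(\<Sum>p\<in>V \<times> V. h p * of_bool (p \<in> Z)) = sum h Z" for h :: "_ \<Rightarrow> real"
    using finV ZV by (simp add: of_bool_def if_distrib[of "\<lambda>c. _ * c"] sum.If_cases Int_absorb1)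
  have gain: "pair_energy (F \<union> F') \<ge> pair_energy F
     + 2 * (\<Sum>p\<in>V \<times> V. ?\<mu> p * (u p - ?f p) * g p) - (\<Sum>p\<in>V \<times> V. ?\<mu> p * (g p)\<^sup>2)"
    unfolding pair_energy_def u_def
    by (rule energy_gain) (use finV in \<open>auto simp: w_nonneg intro!: gfac vtype_mono[of "F \<union> F'" _ _ F]\<close>)
  have "(\<Sum>p\<in>V \<times> V. ?\<mu> p * (u p - ?f p) * g p) = (\<Sum>p\<in>V \<times> V. (d / 2 * (?\<mu> p * u p - ?\<mu> p * ?f p)) * of_bool (p \<in> Z))"
    by (intro sum.cong) (auto simp: g_def algebra_simps)
  also have "\<dots> = d / 2 * (sum (\<lambda>p. ?\<mu> p * u p) Z - sum (\<lambda>p. ?\<mu> p * ?f p) Z)"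
    unfolding sg by (simp only: sum_distrib_left[symmetric] sum_subtractf)
  finally have s1: "(\<Sum>p\<in>V \<times> V. ?\<mu> p * (u p - ?f p) * g p)
      = d / 2 * (sum (\<lambda>p. ?\<mu> p * u p) Z - sum (\<lambda>p. ?\<mu> p * ?f p) Z)" .
  have "(\<Sum>p\<in>V \<times> V. ?\<mu> p * (g p)\<^sup>2) = (\<Sum>p\<in>V \<times> V. (d\<^sup>2 / 4 * ?\<mu> p) * of_bool (p \<in> Z))"
    by (intro sum.cong) (auto simp: g_def power2_eq_square)
  also have "\<dots> = d\<^sup>2 / 4 * sum ?\<mu> Z"
    unfolding sg by (simp only: sum_distrib_left[symmetric])
  finally have s2: "(\<Sum>p\<in>V \<times> V. ?\<mu> p * (g p)\<^sup>2) = d\<^sup>2 / 4 * sum ?\<mu> Z" .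
  have "d * sum ?\<mu> Z \<le> sum (\<lambda>p. ?\<mu> p * u p) Z"
    unfolding sum_distrib_left
    by (rule sum_mono) (use u in \<open>auto simp: w_nonneg mult.commute intro!: mult_right_mono\<close>)
  then have "d / 2 * (d / 2 * sum ?\<mu> Z) \<le> d / 2 * (sum (\<lambda>p. ?\<mu> p * u p) Z - sum (\<lambda>p. ?\<mu> p * ?f p) Z)"
    using sumZ d by (intro mult_left_mono) auto
  then have "d\<^sup>2 / 4 * sum ?\<mu> Z \<le> 2 * (d / 2 * (sum (\<lambda>p. ?\<mu> p * u p) Z - sum (\<lambda>p. ?\<mu> p * ?f p) Z)) - d\<^sup>2 / 4 * sum ?\<mu> Z"
    by (simp add: power2_eq_square)
  then have "pair_energy (F \<union> F') \<ge> pair_energy F + d\<^sup>2 / 4 * sum ?\<mu> Z"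
    using gain unfolding s1 s2 by linarith
  moreover have "d\<^sup>2 / 4 * (\<beta>\<^sup>2 * sum ?\<mu> ?B) \<le> d\<^sup>2 / 4 * sum ?\<mu> Z"
    using massZ by (intro mult_left_mono) auto
  moreover have "sum ?\<mu> ?B = irregular_mass d \<beta> F"
    unfolding irregular_mass_def by (rule sum.cong) auto
  ultimately have "pair_energy (F \<union> F') \<ge> pair_energy F + d\<^sup>2 / 4 * \<beta>\<^sup>2 * irregular_mass d \<beta> F"
    by (simp add: mult.assoc)
  then show ?thesis using that finF' cardF' by blast
qed

section \<open>Splitting off heavy vertices\<close>

lemma sum_w_nonneg: "0 \<le> sum w X"
  by (simp add: sum_nonneg w_nonneg)

lemma w_le_cls: "x \<in> V \<Longrightarrow> w x \<le> sum w (cls F x)"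
  using finite_cls cls_self w_nonneg by (intro member_le_sum) auto

lemma sum_classes:
  fixes h :: "'a \<Rightarrow> real"
  shows "sum h V = (\<Sum>P\<in>cls F ` V. sum h P)"
  unfolding sum.image_gen[OF finV, of h "cls F"]
  by (rule sum.cong[OF refl]) (simp only: fiber_cls)

text \<open>The new sets are the singletons of the vertices heavier than \<eta> times their class.
  Relative weights within a class add up to at most 1, so there are at most 1/\<eta> such vertices
  per class. In a clumpy class they carry more than half of the weight, and all of it becomes
  singleton weight.\<close>

lemma refine_singletons:
  assumes F: "finite F" and \<eta>: "0 < \<eta>"
  obtains F' where "finite F'" "card F' \<le> nat \<lceil>2 ^ card F / \<eta>\<rceil>"
    "singleton_mass (F \<union> F') \<ge> singleton_mass F + clumpy_mass \<eta> F / 2"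
proof -
  define B where "B = {v \<in> V. \<eta> * sum w (cls F v) < w v}"
  let ?F' = "(\<lambda>v. {v}) ` B"
  have finB: "finite B" using finV by (simp add: B_def)
  have "real (card B) * \<eta> \<le> (\<Sum>v\<in>B. w v / sum w (cls F v))"
  proof -
    have "\<eta> \<le> w v / sum w (cls F v)" if v: "v \<in> B" for v
    proof -
      have "0 \<le> \<eta> * sum w (cls F v)" using \<eta> sum_w_nonneg by simp
      then have "0 < sum w (cls F v)"
        using v w_le_cls[of v F] unfolding B_def by simp
      then show ?thesis using v unfolding B_def by (simp add: field_simps)
    qed
    then show ?thesis using sum_mono[of B "\<lambda>_. \<eta>"] by simp
  qed
  also have "\<dots> \<le> (\<Sum>v\<in>V. w v / sum w (cls F v))"
    using finV by (intro sum_mono2) (auto simp: B_def w_nonneg sum_w_nonneg)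
  also have "\<dots> = (\<Sum>P\<in>cls F ` V. \<Sum>v\<in>P. w v / sum w (cls F v))"
    by (rule sum_classes)
  also have "\<dots> \<le> (\<Sum>P\<in>cls F ` V. 1)"
  proof (rule sum_mono)
    fix P assume "P \<in> cls F ` V"
    then have "(\<Sum>v\<in>P. w v / sum w (cls F v)) = (\<Sum>v\<in>P. w v / sum w P)"
      using cls_mem by (intro sum.cong) auto
    then show "(\<Sum>v\<in>P. w v / sum w (cls F v)) \<le> 1"
      by (simp add: sum_divide_distrib[symmetric])
  qed
  also have "\<dots> = real (card (cls F ` V))" by simp
  also have "\<dots> \<le> 2 ^ card F"
    using card_cls[OF F] by (metis of_nat_le_iff of_nat_numeral of_nat_power)
  finally have "real (card B) \<le> 2 ^ card F / \<eta>" using \<eta> by (simp add: field_simps)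
  then have "card B \<le> nat \<lceil>2 ^ card F / \<eta>\<rceil>" by linarith
  then have card: "card ?F' \<le> nat \<lceil>2 ^ card F / \<eta>\<rceil>"
    using card_image_le[OF finB, of "\<lambda>v. {v}"] by linarith
  let ?C = "{x \<in> V. clumpy \<eta> (cls F x)}" and ?S = "{x. x \<in> V \<and> cls F x = {x}}"
  let ?S' = "{x. x \<in> V \<and> cls (F \<union> ?F') x = {x}}"
  \<comment> \<open>Old singletons are never clumpy, so the weight gained is disjoint from the
    singleton weight already present.\<close>
  have not_single: "\<not> is_singleton P" if "clumpy \<eta> P" for P
    using that sum_w_nonneg[of P] by (auto simp: clumpy_def light_part_def)
  have "(\<Sum>x\<in>P. w x * of_bool (clumpy \<eta> (cls F x))) / 2
      \<le> (\<Sum>x\<in>P. w x * of_bool (x \<in> ?C \<inter> B))" if P: "P \<in> cls F ` V" for P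
  proof (cases "clumpy \<eta> P")
    case False
    have "(\<Sum>x\<in>P. w x * of_bool (clumpy \<eta> (cls F x))) = 0"
      using P False by (intro sum.neutral) (auto dest: cls_mem)
    moreover have "0 \<le> (\<Sum>x\<in>P. w x * of_bool (x \<in> ?C \<inter> B))"
      by (intro sum_nonneg) (simp add: w_nonneg)
    ultimately show ?thesis by linarith
  next
    case True
    have finP: "finite P" using P finite_cls by auto
    have PC: "cls F x = P" if "x \<in> P" for x using P that cls_mem by auto
    have PV: "P \<subseteq> V" using P cls_subset by auto
    have "sum w P = (\<Sum>x\<in>P. w x * of_bool (clumpy \<eta> (cls F x)))"
      using True PC by (intro sum.cong) auto
    moreover have "sum w (P - light_part \<eta> P) = sum w P - sum w (light_part \<eta> P)"
      using finP by (intro sum_diff) (auto simp: light_part_def)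
    moreover have "sum w (P - light_part \<eta> P) \<le> (\<Sum>x\<in>P. w x * of_bool (x \<in> ?C \<inter> B))"
    proof -
      have "P - light_part \<eta> P \<subseteq> P \<inter> {x. x \<in> ?C \<inter> B}"
        using True PC PV by (auto simp: light_part_def B_def)
      then have "sum w (P - light_part \<eta> P) \<le> sum w (P \<inter> {x. x \<in> ?C \<inter> B})"
        using finP by (intro sum_mono2) (auto simp: w_nonneg)
      also have "\<dots> = (\<Sum>x\<in>P. if x \<in> ?C \<inter> B then w x else 0)"
        using finP by (simp add: sum.If_cases)
      also have "\<dots> = (\<Sum>x\<in>P. w x * of_bool (x \<in> ?C \<inter> B))"
        by (intro sum.cong) auto
      finally show ?thesis .
    qed
    ultimately show ?thesis using True unfolding clumpy_def by linarith
  qed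
  then have "(\<Sum>x\<in>V. w x * of_bool (clumpy \<eta> (cls F x))) / 2 \<le> (\<Sum>x\<in>V. w x * of_bool (x \<in> ?C \<inter> B))"
    unfolding sum_classes[of _ F] by (simp only: sum_divide_distrib) (rule sum_mono)
  moreover have "(\<Sum>x\<in>V. w x * of_bool (clumpy \<eta> (cls F x))) = clumpy_mass \<eta> F"
    unfolding clumpy_mass_def using finV by (intro sum.mono_neutral_cong_right) auto
  moreover have "(\<Sum>x\<in>V. w x * of_bool (x \<in> ?C \<inter> B)) = sum w (?C \<inter> B)"
    using finV by (intro sum.mono_neutral_cong_right) auto
  moreover have "sum w ?S + sum w (?C \<inter> B) \<le> sum w ?S'"
  proof -
    have "?S \<inter> (?C \<inter> B) = {}" using not_single by (auto simp: is_singleton_def)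
    then have "sum w ?S + sum w (?C \<inter> B) = sum w (?S \<union> (?C \<inter> B))"
      using finV finB by (intro sum.union_disjoint[symmetric]) auto
    also have "\<dots> \<le> sum w ?S'"
    proof (rule sum_mono2)
      have "cls (F \<union> ?F') x = {x}" if "x \<in> V" "x \<in> B \<or> cls F x = {x}" for x
      proof (rule subset_antisym)
        show "{x} \<subseteq> cls (F \<union> ?F') x" using cls_self that by blast
        show "cls (F \<union> ?F') x \<subseteq> {x}"
        proof
          fix y assume y: "y \<in> cls (F \<union> ?F') x"
          then have t: "vtype (F \<union> ?F') y = vtype (F \<union> ?F') x" "y \<in> V" by (auto simp: cls_def)
          have "y \<in> cls F x" using t vtype_mono[OF t(1), of F] by (auto simp: cls_def)
          moreover have "y \<in> {x}" if "x \<in> B" using vtype_mem[OF t(1), of "{x}"] that by auto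
          ultimately show "y \<in> {x}" using that by auto
        qed
      qed
      then show "?S \<union> (?C \<inter> B) \<subseteq> ?S'" by blast
    qed (use finV w_nonneg in auto)
    finally show ?thesis .
  qed
  ultimately have "singleton_mass (F \<union> ?F') \<ge> singleton_mass F + clumpy_mass \<eta> F / 2"
    unfolding singleton_mass_def by linarith
  then show ?thesis using that[of ?F'] card finB by blast
qed

section \<open>Iterating both refinements\<close>

definition potential :: "'a set set \<Rightarrow> real" where
  "potential F = pair_energy F + singleton_mass F"

end

text \<open>The summands are the old family, the sparse spots and the new singletons. It stands
  outside the locale because the size bound must not mention the graph.\<close>

definition grow :: "real \<Rightarrow> nat \<Rightarrow> nat" where
  "grow \<eta> n = n + 2 * 4 ^ n + nat \<lceil>2 ^ n / \<eta>\<rceil>"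

lemma grow_mono:
  assumes "0 < \<eta>" "m \<le> n"
  shows "grow \<eta> m \<le> grow \<eta> n"
proof -
  have "(4::nat) ^ m \<le> 4 ^ n" using assms by (intro power_increasing) auto
  moreover have "(2::real) ^ m / \<eta> \<le> 2 ^ n / \<eta>"
    using assms by (intro divide_right_mono power_increasing) auto
  then have "nat \<lceil>2 ^ m / \<eta>\<rceil> \<le> nat \<lceil>2 ^ n / \<eta>\<rceil>" by (intro nat_mono ceiling_mono)
  ultimately show ?thesis using assms(2) unfolding grow_def by linarith
qed

lemma grow_ge: "n \<le> grow \<eta> n"
  by (simp add: grow_def)

context weighted_graph
begin

text \<open>Both refinements start from the same \<open>F\<close>; monotonicity lets their common
  refinement keep both gains.\<close>

lemma refine_potential:
  assumes "finite F" "0 < d" "0 < \<beta>" "0 < \<eta>"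
  obtains F' where "finite F'" "card F' \<le> grow \<eta> (card F)"
    "potential F + d\<^sup>2 / 4 * \<beta>\<^sup>2 * irregular_mass d \<beta> F + clumpy_mass \<eta> F / 2 \<le> potential F'"
proof -
  obtain F1 where F1: "finite F1" "card F1 \<le> 2 * 4 ^ card F"
    "pair_energy (F \<union> F1) \<ge> pair_energy F + d\<^sup>2 / 4 * \<beta>\<^sup>2 * irregular_mass d \<beta> F"
    using refine_energy assms by blast
  obtain F2 where F2: "finite F2" "card F2 \<le> nat \<lceil>2 ^ card F / \<eta>\<rceil>"
    "singleton_mass (F \<union> F2) \<ge> singleton_mass F + clumpy_mass \<eta> F / 2"
    using refine_singletons assms by blast
  let ?F = "F \<union> F1 \<union> F2"
  have "card ?F \<le> card F + card F1 + card F2"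
    using card_Un_le[of F F1] card_Un_le[of "F \<union> F1" F2] by linarith
  then have "card ?F \<le> grow \<eta> (card F)"
    using F1(2) F2(2) unfolding grow_def by linarith
  moreover have "pair_energy (F \<union> F1) \<le> pair_energy ?F" "singleton_mass (F \<union> F2) \<le> singleton_mass ?F"
    by (auto intro!: pair_energy_mono singleton_mass_mono)
  ultimately show ?thesis
    using that[of ?F] F1 F2 assms(1) unfolding potential_def by auto
qed

lemma irregular_mass_nonneg: "0 \<le> irregular_mass d \<beta> F"
  unfolding irregular_mass_def by (intro sum_nonneg) (auto simp: w_nonneg)

lemma clumpy_mass_nonneg: "0 \<le> clumpy_mass \<eta> F"
  unfolding clumpy_mass_def by (intro sum_nonneg) (auto simp: w_nonneg)

text \<open>As long as one of the two masses is at least \<tau>, a refinement raises the potential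
  by at least the minimum in the last hypothesis. The potential is at most 2, one for each summand,
  so this cannot happen \<open>K\<close> times. The induction carries the alternative: a good family
  within the current size bound, or one whose potential has grown \<open>k\<close> times.\<close>

lemma exists_regular_family:
  assumes pos: "0 < d" "0 < \<beta>" "0 < \<eta>" "0 < \<tau>"
    and K: "2 < real K * min (d\<^sup>2 / 4 * \<beta>\<^sup>2 * \<tau>) (\<tau> / 2)"
  obtains F where "finite F" "card F \<le> (grow \<eta> ^^ K) 0"
    "irregular_mass d \<beta> F < \<tau>" "clumpy_mass \<eta> F < \<tau>"
proof -
  define \<gamma> where "\<gamma> = min (d\<^sup>2 / 4 * \<beta>\<^sup>2 * \<tau>) (\<tau> / 2)"
  let ?good = "\<lambda>k. \<exists>F. finite F \<and> card F \<le> (grow \<eta> ^^ k) 0 \<and>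
    irregular_mass d \<beta> F < \<tau> \<and> clumpy_mass \<eta> F < \<tau>"
  have "?good k \<or> (\<exists>F. finite F \<and> card F \<le> (grow \<eta> ^^ k) 0 \<and> real k * \<gamma> \<le> potential F)" for k
  proof (induction k)
    case 0
    have "0 \<le> potential {}"
      using pair_energy_bounds(1)[of "{}"] singleton_mass_bounds(1)[of "{}"] unfolding potential_def by linarith
    then show ?case by (intro disjI2 exI[of _ "{}"]) simp
  next
    case (Suc k)
    have le: "(grow \<eta> ^^ k) 0 \<le> (grow \<eta> ^^ Suc k) 0" by (simp add: grow_ge)
    show ?case
    proof (cases "?good k")
      case True
      then show ?thesis using le order_trans by blast
    next
      case False
      then obtain F where F: "finite F" "card F \<le> (grow \<eta> ^^ k) 0" "real k * \<gamma> \<le> potential F"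
        using Suc.IH by blast
      then have "\<tau> \<le> irregular_mass d \<beta> F \<or> \<tau> \<le> clumpy_mass \<eta> F"
        using False by (meson not_le)
      then have gain: "\<gamma> \<le> d\<^sup>2 / 4 * \<beta>\<^sup>2 * irregular_mass d \<beta> F + clumpy_mass \<eta> F / 2"
      proof
        assume "\<tau> \<le> irregular_mass d \<beta> F"
        then have "d\<^sup>2 / 4 * \<beta>\<^sup>2 * \<tau> \<le> d\<^sup>2 / 4 * \<beta>\<^sup>2 * irregular_mass d \<beta> F"
          by (intro mult_left_mono) auto
        then show ?thesis using clumpy_mass_nonneg[of \<eta> F] unfolding \<gamma>_def by linarith
      next
        assume "\<tau> \<le> clumpy_mass \<eta> F"
        moreover have "0 \<le> d\<^sup>2 / 4 * \<beta>\<^sup>2 * irregular_mass d \<beta> F"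
          by (simp add: irregular_mass_nonneg)
        ultimately show ?thesis unfolding \<gamma>_def by linarith
      qed
      obtain F' where F': "finite F'" "card F' \<le> grow \<eta> (card F)"
        "potential F + d\<^sup>2 / 4 * \<beta>\<^sup>2 * irregular_mass d \<beta> F + clumpy_mass \<eta> F / 2 \<le> potential F'"
        using refine_potential[OF F(1) pos(1-3)] by blast
      have "card F' \<le> (grow \<eta> ^^ Suc k) 0"
        using F'(2) grow_mono[OF pos(3) F(2)] by simp
      moreover have "real (Suc k) * \<gamma> \<le> potential F'"
        using F'(3) F(3) gain by (simp add: algebra_simps)
      ultimately show ?thesis using F'(1) by blast
    qed
  qed
  from this[of K] have "?good K"
  proof
    assume "\<exists>F. finite F \<and> card F \<le> (grow \<eta> ^^ K) 0 \<and> real K * \<gamma> \<le> potential F"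
    then obtain F where "real K * \<gamma> \<le> potential F" by blast
    then show ?thesis
      using K pair_energy_bounds(2)[of F] singleton_mass_bounds(2)[of F]
      unfolding potential_def \<gamma>_def by linarith
  qed
  then show ?thesis using that by blast
qed

section \<open>Cleaning the graph and the weight of the deleted edges\<close>

definition kept :: "real \<Rightarrow> real \<Rightarrow> real \<Rightarrow> real \<Rightarrow> 'a set set \<Rightarrow> 'a \<Rightarrow> 'a \<Rightarrow> bool" where
  "kept d \<beta> \<eta> \<theta> F x y \<longleftrightarrow>
     \<theta> \<le> sum w (cls F x) \<and> \<theta> \<le> sum w (cls F y) \<and> \<not> clumpy \<eta> (cls F x) \<and> \<not> clumpy \<eta> (cls F y) \<and>
     d \<le> density (cls F x) (cls F y) \<and> \<not> irregular d \<beta> (cls F x) (cls F y)"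

lemma sum_left_event:
  "(\<Sum>(x, y)\<in>V \<times> V. w x * w y * of_bool (p x)) = (\<Sum>x\<in>V. w x * of_bool (p x))"
  "(\<Sum>(x, y)\<in>V \<times> V. w x * w y * of_bool (p y)) = (\<Sum>x\<in>V. w x * of_bool (p x))"
proof -
  have "(\<Sum>(x, y)\<in>V \<times> V. w x * w y * of_bool (p x)) = (\<Sum>x\<in>V. w x * of_bool (p x)) * sum w V"
    unfolding sum_product sum.cartesian_product by (intro sum.cong) auto
  then show "(\<Sum>(x, y)\<in>V \<times> V. w x * w y * of_bool (p x)) = (\<Sum>x\<in>V. w x * of_bool (p x))"
    by (simp add: sum_w)
  have "(\<Sum>(x, y)\<in>V \<times> V. w x * w y * of_bool (p y)) = sum w V * (\<Sum>x\<in>V. w x * of_bool (p x))"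
    unfolding sum_product sum.cartesian_product by (intro sum.cong) auto
  then show "(\<Sum>(x, y)\<in>V \<times> V. w x * w y * of_bool (p y)) = (\<Sum>x\<in>V. w x * of_bool (p x))"
    by (simp add: sum_w)
qed

lemma small_classes_mass:
  assumes F: "finite F" and \<theta>: "0 < \<theta>"
  shows "(\<Sum>x\<in>V. w x * of_bool (sum w (cls F x) < \<theta>)) \<le> 2 ^ card F * \<theta>"
proof -
  have "(\<Sum>x\<in>V. w x * of_bool (sum w (cls F x) < \<theta>))
      = (\<Sum>P\<in>cls F ` V. \<Sum>x\<in>P. w x * of_bool (sum w (cls F x) < \<theta>))"
    by (rule sum_classes)
  also have "\<dots> \<le> (\<Sum>P\<in>cls F ` V. \<theta>)"
  proof (rule sum_mono)
    fix P assume "P \<in> cls F ` V"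
    then have "(\<Sum>x\<in>P. w x * of_bool (sum w (cls F x) < \<theta>)) = sum w P * of_bool (sum w P < \<theta>)"
      unfolding sum_distrib_right using cls_mem by (intro sum.cong) auto
    then show "(\<Sum>x\<in>P. w x * of_bool (sum w (cls F x) < \<theta>)) \<le> \<theta>" using \<theta> by auto
  qed
  also have "\<dots> = real (card (cls F ` V)) * \<theta>" by simp
  also have "\<dots> \<le> 2 ^ card F * \<theta>"
  proof (rule mult_right_mono)
    show "real (card (cls F ` V)) \<le> 2 ^ card F"
      using card_cls[OF F] by (metis of_nat_le_iff of_nat_numeral of_nat_power)
  qed (use \<theta> in simp)
  finally show ?thesis .
qed

text \<open>Being a sparse pair depends only on the classes, so adjacency may be replaced by its
  conditional average, which is below \<open>d\<close> wherever it counts.\<close>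

lemma sparse_pairs_mass:
  assumes "0 < d"
  shows "(\<Sum>(x, y)\<in>V \<times> V. w x * w y * of_bool (A x y) * of_bool (density (cls F x) (cls F y) < d)) \<le> d"
proof -
  let ?\<mu> = "\<lambda>(x, y). w x * w y" and ?f = "\<lambda>(x, y). of_bool (A x y) :: real"
  let ?c = "cavg (V \<times> V) ?\<mu> (map_prod (vtype F) (vtype F)) ?f"
  let ?g = "\<lambda>p. of_bool (?c p < d) :: real"
  have "(\<Sum>(x, y)\<in>V \<times> V. w x * w y * of_bool (A x y) * of_bool (density (cls F x) (cls F y) < d))
      = (\<Sum>p\<in>V \<times> V. ?\<mu> p * ?f p * ?g p)"
    by (intro sum.cong) (auto simp: cavg_vtype)
  also have "\<dots> = (\<Sum>p\<in>V \<times> V. ?\<mu> p * ?c p * ?g p)"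
  proof (rule sum_cavg[symmetric])
    fix p q assume "map_prod (vtype F) (vtype F) p = map_prod (vtype F) (vtype F) q"
    then have "?c p = ?c q" by (rule cavg_cong)
    then show "?g p = ?g q" by simp
  qed (auto simp: finV w_nonneg)
  also have "\<dots> \<le> (\<Sum>p\<in>V \<times> V. ?\<mu> p * d)"
  proof (rule sum_mono)
    fix p
    have "?c p * ?g p \<le> d" using assms by auto
    then have "?\<mu> p * (?c p * ?g p) \<le> ?\<mu> p * d"
      by (intro mult_left_mono) (auto simp: w_nonneg case_prod_unfold)
    then show "?\<mu> p * ?c p * ?g p \<le> ?\<mu> p * d" by (simp only: mult.assoc)
  qed
  also have "\<dots> = d" by (simp only: sum_distrib_right[symmetric] sum_prod_w sum_w mult_1)
  finally show ?thesis .
qed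

lemma lost_mass:
  assumes F: "finite F" and pos: "0 < d" "0 < \<theta>"
  shows "(\<Sum>(x, y) | (x, y) \<in> V \<times> V \<and> A x y \<and> \<not> kept d \<beta> \<eta> \<theta> F x y. w x * w y)
    \<le> 2 * (2 ^ card F * \<theta>) + 2 * clumpy_mass \<eta> F + d + irregular_mass d \<beta> F"
proof -
  let ?small = "\<lambda>x. sum w (cls F x) < \<theta>" and ?cl = "\<lambda>x. clumpy \<eta> (cls F x)"
  let ?irr = "\<lambda>x y. irregular d \<beta> (cls F x) (cls F y)"
  let ?sp = "\<lambda>x y. density (cls F x) (cls F y) < d"
  have "(\<Sum>(x, y) | (x, y) \<in> V \<times> V \<and> A x y \<and> \<not> kept d \<beta> \<eta> \<theta> F x y. w x * w y)
      = (\<Sum>(x, y)\<in>V \<times> V. w x * w y * of_bool (A x y \<and> \<not> kept d \<beta> \<eta> \<theta> F x y))"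
    using finV by (intro sum.mono_neutral_cong_left) auto
  also have "\<dots> \<le> (\<Sum>(x, y)\<in>V \<times> V. w x * w y * of_bool (?small x) + w x * w y * of_bool (?small y)
      + w x * w y * of_bool (?cl x) + w x * w y * of_bool (?cl y)
      + w x * w y * of_bool (A x y) * of_bool (?sp x y) + w x * w y * of_bool (?irr x y))"
  proof (rule sum_mono)
    fix p :: "'a \<times> 'a"
    obtain x y where p: "p = (x, y)" by (cases p)
    \<comment> \<open>Union bound over the reasons for deletion; those concerning a single class
      occur once for each endpoint.\<close>
    have "of_bool (A x y \<and> \<not> kept d \<beta> \<eta> \<theta> F x y) \<le> (of_bool (?small x) + of_bool (?small y)
      + of_bool (?cl x) + of_bool (?cl y) + of_bool (A x y) * of_bool (?sp x y) + of_bool (?irr x y) :: real)"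
      by (auto simp: kept_def)
    then have "w x * w y * of_bool (A x y \<and> \<not> kept d \<beta> \<eta> \<theta> F x y) \<le> w x * w y * (of_bool (?small x) + of_bool (?small y)
      + of_bool (?cl x) + of_bool (?cl y) + of_bool (A x y) * of_bool (?sp x y) + of_bool (?irr x y) :: real)"
      by (intro mult_left_mono) (auto simp: w_nonneg)
    then show "(case p of (x, y) \<Rightarrow> w x * w y * of_bool (A x y \<and> \<not> kept d \<beta> \<eta> \<theta> F x y))
      \<le> (case p of (x, y) \<Rightarrow> w x * w y * of_bool (?small x) + w x * w y * of_bool (?small y)
      + w x * w y * of_bool (?cl x) + w x * w y * of_bool (?cl y)
      + w x * w y * of_bool (A x y) * of_bool (?sp x y) + w x * w y * of_bool (?irr x y))"
      unfolding p by (simp only: prod.case distrib_left mult.assoc)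
  qed
  also have "\<dots> = 2 * (\<Sum>x\<in>V. w x * of_bool (?small x)) + 2 * (\<Sum>x\<in>V. w x * of_bool (?cl x))
      + (\<Sum>(x, y)\<in>V \<times> V. w x * w y * of_bool (A x y) * of_bool (?sp x y))
      + (\<Sum>(x, y)\<in>V \<times> V. w x * w y * of_bool (?irr x y))"
    using sum_left_event[of ?small] sum_left_event[of ?cl]
    by (simp add: case_prod_unfold sum.distrib)
  also have "(\<Sum>x\<in>V. w x * of_bool (?cl x)) = clumpy_mass \<eta> F"
    unfolding clumpy_mass_def using finV by (intro sum.mono_neutral_cong_right) auto
  also have "(\<Sum>(x, y)\<in>V \<times> V. w x * w y * of_bool (?irr x y)) = irregular_mass d \<beta> F"
    unfolding irregular_mass_def using finV by (intro sum.mono_neutral_cong_right) auto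
  finally show ?thesis
    using small_classes_mass[OF F pos(2)] sparse_pairs_mass[OF pos(1), of F] by linarith
qed

end

section \<open>Counting copies\<close>

text \<open>Position \<open>i\<close> of the list holds the image of vertex \<open>i\<close> of the
  pattern. Distinctness is what separates copies from homomorphisms.\<close>

definition is_copy :: "(nat \<Rightarrow> nat \<Rightarrow> bool) \<Rightarrow> ('a \<Rightarrow> 'a \<Rightarrow> bool) \<Rightarrow> 'a list \<Rightarrow> bool" where
  "is_copy E A xs \<longleftrightarrow> distinct xs \<and> (\<forall>i<length xs. \<forall>j<length xs. E i j \<longrightarrow> A (xs ! i) (xs ! j))"

context weighted_graph
begin

text \<open>Probability that \<open>xs\<close>, continued by \<open>n\<close> independent samples,
  satisfies \<open>c\<close>; the recursion follows the sampling tree of the algorithm.\<close>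

primrec hit :: "('a list \<Rightarrow> bool) \<Rightarrow> nat \<Rightarrow> 'a list \<Rightarrow> real" where
  "hit c 0 xs = of_bool (c xs)"
| "hit c (Suc n) xs = (\<Sum>v\<in>V. w v * hit c n (xs @ [v]))"

lemma hit_nonneg: "0 \<le> hit c n xs"
  by (induction n arbitrary: xs) (auto intro!: sum_nonneg simp: w_nonneg)

lemma hit_le_1: "hit c n xs \<le> 1"
proof (induction n arbitrary: xs)
  case (Suc n)
  have "hit c (Suc n) xs \<le> (\<Sum>v\<in>V. w v * 1)"
    unfolding hit.simps using Suc by (intro sum_mono mult_left_mono) (auto simp: w_nonneg)
  then show ?case by (simp add: sum_w)
qed simp

lemma hit_eq_0:
  assumes "\<And>ys. set ys \<subseteq> V \<Longrightarrow> length ys = length xs + n \<Longrightarrow> \<not> c ys" and "set xs \<subseteq> V"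
  shows "hit c n xs = 0"
  using assms by (induction n arbitrary: xs) auto

lemma edge_mass_nbhd:
  assumes "finite Y"
  shows "edge_mass X Y = (\<Sum>x\<in>X. w x * sum w (Y \<inter> {y. A x y}))"
proof -
  have "edge_mass X Y = (\<Sum>x\<in>X. \<Sum>y\<in>Y. w x * w y * of_bool (A x y))"
    by (simp add: edge_mass_def sum.cartesian_product)
  also have "\<dots> = (\<Sum>x\<in>X. w x * (\<Sum>y\<in>Y. if y \<in> {y. A x y} then w y else 0))"
    unfolding sum_distrib_left by (intro sum.cong) auto
  also have "\<dots> = (\<Sum>x\<in>X. w x * sum w (Y \<inter> {y. A x y}))"
    using assms by (simp add: sum.inter_restrict)
  finally show ?thesis .
qed

text \<open>Otherwise the vertices of low degree into \<open>Y\<close> would themselves form,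
  together with \<open>Y\<close>, a pair that is too sparse.\<close>

lemma few_low_degree:
  assumes dense: "\<And>X. X \<subseteq> B \<Longrightarrow> b \<le> sum w X \<Longrightarrow> c * (sum w X * sum w Y) < edge_mass X Y"
    and "finite Y"
  shows "sum w {x \<in> B. sum w (Y \<inter> {y. A x y}) \<le> c * sum w Y} < b"
proof (rule ccontr)
  let ?X = "{x \<in> B. sum w (Y \<inter> {y. A x y}) \<le> c * sum w Y}"
  assume "\<not> sum w ?X < b"
  then have "c * (sum w ?X * sum w Y) < edge_mass ?X Y"
    by (intro dense) auto
  also have "\<dots> \<le> (\<Sum>x\<in>?X. w x * (c * sum w Y))"
    unfolding edge_mass_nbhd[OF assms(2)] by (intro sum_mono mult_left_mono) (auto simp: w_nonneg)
  also have "\<dots> = c * (sum w ?X * sum w Y)"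
    by (simp add: sum_distrib_right[symmetric])
  finally show False by simp
qed

lemma sum_w_UN_le:
  assumes "finite J"
  shows "sum w (\<Union>j\<in>J. B j) \<le> (\<Sum>j\<in>J. sum w (B j))"
  using assms
proof (induction J)
  case (insert a J)
  have "sum w (B a \<union> (\<Union>j\<in>J. B j)) \<le> sum w (B a) + sum w (\<Union>j\<in>J. B j)"
  proof (cases "finite (B a) \<and> finite (\<Union>j\<in>J. B j)")
    case True
    then show ?thesis
      using sum.union_inter[of "B a" "\<Union>j\<in>J. B j" w] sum_w_nonneg[of "B a \<inter> (\<Union>j\<in>J. B j)"] by linarith
  next
    \<comment> \<open>If one of the sets is infinite, so is their union, and its sum is 0 by
      default.\<close>
    case False
    then have "sum w (B a \<union> (\<Union>j\<in>J. B j)) = 0" by (intro sum.infinite) auto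
    then show ?thesis using sum_w_nonneg[of "B a"] sum_w_nonneg[of "\<Union>j\<in>J. B j"] by linarith
  qed
  then show ?case using insert by auto
qed simp

text \<open>Greedy embedding: \<open>C j\<close> is the set of candidates for the image of \<open>j\<close>; each new vertex is
  chosen to have large degree into all candidate sets that it restricts.\<close>

lemma hit_lower_bound:
  fixes W :: "nat \<Rightarrow> real" and C\<^sub>0 :: "nat \<Rightarrow> 'a set"
  assumes sym: "\<And>x y. A x y \<Longrightarrow> A y x" and irrefl: "\<And>x. \<not> A x x"
    and Esym: "\<And>i j. E i j \<Longrightarrow> E j i" and Eirrefl: "\<And>i. \<not> E i i"
    and d: "0 < d" "d \<le> 1" and r: "0 < r"
    and \<rho>: "\<rho> = r * (d / 2) ^ h" and \<beta>: "\<beta> = \<rho> / (2 * (real h + 1))" and \<eta>: "\<eta> = \<rho> / 2"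
    and \<theta>: "0 < \<theta>" "\<And>i. i < h \<Longrightarrow> \<theta> \<le> W i"
    and C\<^sub>0V: "\<And>j. C\<^sub>0 j \<subseteq> V"
    and overlap: "\<And>i j x. i < h \<Longrightarrow> j < h \<Longrightarrow> i \<noteq> j \<Longrightarrow> x \<in> C\<^sub>0 i \<Longrightarrow> x \<in> C\<^sub>0 j \<Longrightarrow> w x \<le> \<eta> * W j"
    and dense: "\<And>i j X Y. i < h \<Longrightarrow> j < h \<Longrightarrow> E i j \<Longrightarrow> X \<subseteq> C\<^sub>0 i \<Longrightarrow> Y \<subseteq> C\<^sub>0 j \<Longrightarrow>
       \<beta> * W i \<le> sum w X \<Longrightarrow> \<beta> * W j \<le> sum w Y \<Longrightarrow> d / 2 * (sum w X * sum w Y) < edge_mass X Y"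
  shows "length xs + n = h \<Longrightarrow> is_copy E A xs \<Longrightarrow>
    (\<And>j. length xs \<le> j \<Longrightarrow> j < h \<Longrightarrow> C j \<subseteq> C\<^sub>0 j \<and> set xs \<inter> C j = {} \<and>
       (\<forall>i<length xs. E i j \<longrightarrow> C j \<subseteq> {y. A (xs ! i) y}) \<and>
       r * (d / 2) ^ length xs * W j \<le> sum w (C j)) \<Longrightarrow>
    (\<rho> / 2 * \<theta>) ^ n \<le> hit (is_copy E A) n xs"
proof (induction n arbitrary: xs C)
  case 0
  then show ?case by simp
next
  case (Suc n)
  define k where "k = length xs"
  have kh: "k < h" using Suc.prems(1) k_def by simp
  have C: "C j \<subseteq> C\<^sub>0 j" "set xs \<inter> C j = {}" "\<And>i. i < k \<Longrightarrow> E i j \<Longrightarrow> C j \<subseteq> {y. A (xs ! i) y}"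
    "r * (d / 2) ^ k * W j \<le> sum w (C j)" if "k \<le> j" "j < h" for j
    using Suc.prems(3)[of j] that unfolding k_def by auto
  have Wpos: "0 < W j" if "j < h" for j using \<theta>(1) \<theta>(2)[OF that] by linarith
  have \<rho>pos: "0 < \<rho>" using d r unfolding \<rho> by simp
  have pow: "\<rho> \<le> r * (d / 2) ^ k"
    unfolding \<rho> using r d kh by (intro mult_left_mono power_decreasing) auto
  have C\<rho>: "\<rho> * W j \<le> sum w (C j)" if "k \<le> j" "j < h" for j
    using mult_right_mono[OF pow, of "W j"] C(4)[OF that] Wpos[OF that(2)] by linarith
  have "\<beta> \<le> \<rho>" unfolding \<beta> using \<rho>pos by (simp add: field_simps)
  then have C\<beta>: "\<beta> * W j \<le> sum w (C j)" if "k \<le> j" "j < h" for j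
    using mult_right_mono[of \<beta> \<rho> "W j"] C\<rho>[OF that] Wpos[OF that(2)] by linarith
  have finC: "finite (C j)" if "k \<le> j" "j < h" for j
    using C(1)[OF that] C\<^sub>0V finV by (meson finite_subset)
  define J where "J = {j. k < j \<and> j < h \<and> E k j}"
  define bad where "bad j = {x \<in> C k. sum w (C j \<inter> {y. A x y}) \<le> d / 2 * sum w (C j)}" for j
  define good where "good = C k - (\<Union>j\<in>J. bad j)"
  have J: "finite J" "card J \<le> h"
    using card_mono[of "{..<h}" J] unfolding J_def by auto
  have bad: "sum w (bad j) \<le> \<beta> * W k" if j: "j \<in> J" for j
  proof -
    have jj: "k \<le> j" "j < h" "E k j" using j unfolding J_def by auto
    have "sum w (bad j) < \<beta> * W k"
      unfolding bad_def
    proof (rule few_low_degree)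
      fix X assume X: "X \<subseteq> C k" "\<beta> * W k \<le> sum w X"
      show "d / 2 * (sum w X * sum w (C j)) < edge_mass X (C j)"
        using X C(1)[OF order_refl kh] C(1)[OF jj(1,2)] C\<beta>[OF jj(1,2)] kh jj
        by (intro dense) auto
    qed (rule finC[OF jj(1,2)])
    then show ?thesis by simp
  qed
  have "sum w (\<Union>j\<in>J. bad j) \<le> (\<Sum>j\<in>J. sum w (bad j))"
    by (rule sum_w_UN_le[OF J(1)])
  also have "\<dots> \<le> (\<Sum>j\<in>J. \<beta> * W k)" by (rule sum_mono[OF bad])
  also have "\<dots> = real (card J) * (\<beta> * W k)" by simp
  \<comment> \<open>The denominator of \<beta> is made for this: the bad sets of at most
    \<open>h\<close> later neighbours use up at most half of the weight \<open>\<rho> * W k\<close>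
    guaranteed to \<open>C k\<close>.\<close>
  also have "\<dots> \<le> (real h + 1) * (\<beta> * W k)"
    using J(2) \<rho>pos Wpos[OF kh] unfolding \<beta> by (intro mult_right_mono) auto
  also have "\<dots> = \<rho> / 2 * W k" unfolding \<beta> by (simp add: field_simps)
  finally have "sum w (\<Union>j\<in>J. bad j) \<le> \<rho> / 2 * W k" .
  moreover have "sum w good = sum w (C k) - sum w (\<Union>j\<in>J. bad j)"
    unfolding good_def by (rule sum_diff) (auto simp: finC kh bad_def)
  ultimately have "\<rho> / 2 * W k \<le> sum w good"
    using C\<rho>[OF order_refl kh] by linarith
  moreover have "\<rho> / 2 * \<theta> \<le> \<rho> / 2 * W k"
    using \<theta>(2)[OF kh] \<rho>pos by (intro mult_left_mono) auto
  ultimately have good: "\<rho> / 2 * \<theta> \<le> sum w good" by linarith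
  have step: "(\<rho> / 2 * \<theta>) ^ n \<le> hit (is_copy E A) n (xs @ [x])" if x: "x \<in> good" for x
  proof -
    \<comment> \<open>Neighbours of \<open>k\<close> keep only candidates adjacent to
      \<open>x\<close>, and irreflexivity excludes \<open>x\<close> itself; for the other vertices
      \<open>x\<close> has to be removed by hand.\<close>
    let ?C = "\<lambda>j. if E k j then C j \<inter> {y. A x y} else C j - {x}"
    have xC: "x \<in> C k" using x unfolding good_def by auto
    have "is_copy E A (xs @ [x])"
      unfolding is_copy_def
    proof (intro conjI allI impI)
      show "distinct (xs @ [x])"
        using Suc.prems(2) C(2)[OF order_refl kh] xC unfolding is_copy_def by auto
      fix i j assume ij: "i < length (xs @ [x])" "j < length (xs @ [x])" "E i j"
      have xs: "A (xs ! i) (xs ! j)" if "i < k" "j < k" "E i j" for i j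
        using Suc.prems(2) that unfolding is_copy_def k_def by blast
      have last: "A (xs ! i) x" if "i < k" "E i k" for i
        using C(3)[OF order_refl kh that] xC by blast
      have "i < k \<or> i = k" "j < k \<or> j = k" using ij unfolding k_def by auto
      then show "A ((xs @ [x]) ! i) ((xs @ [x]) ! j)"
        using ij(3) xs[of i j] last[of i] last[of j] sym[of "xs ! j" x] Esym[of i j] Eirrefl[of i]
        by (auto simp: nth_append k_def)
    qed
    moreover have "?C j \<subseteq> C\<^sub>0 j \<and> set (xs @ [x]) \<inter> ?C j = {} \<and>
       (\<forall>i<length (xs @ [x]). E i j \<longrightarrow> ?C j \<subseteq> {y. A ((xs @ [x]) ! i) y}) \<and>
       r * (d / 2) ^ length (xs @ [x]) * W j \<le> sum w (?C j)"
      if j: "length (xs @ [x]) \<le> j" "j < h" for j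
    proof (intro conjI allI impI)
      have kj: "k < j" "k \<le> j" using j unfolding k_def by auto
      show "?C j \<subseteq> C\<^sub>0 j" using C(1)[OF kj(2) j(2)] by auto
      show "set (xs @ [x]) \<inter> ?C j = {}" using C(2)[OF kj(2) j(2)] irrefl by auto
      show "?C j \<subseteq> {y. A ((xs @ [x]) ! i) y}" if "i < length (xs @ [x])" "E i j" for i
      proof (cases "i < k")
        case True
        then show ?thesis using C(3)[OF kj(2) j(2) True that(2)] by (auto simp: nth_append k_def)
      next
        case False
        then have "i = k" using that unfolding k_def by auto
        then show ?thesis using that by (auto simp: nth_append k_def)
      qed
      have "d / 2 * sum w (C j) \<le> sum w (?C j)"
      proof (cases "E k j")
        case True
        then have "j \<in> J" using kj j unfolding J_def by auto
        then show ?thesis using x xC True unfolding good_def bad_def by auto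
      next
        case False
        \<comment> \<open>Since \<eta> is half of \<rho>, the chosen vertex takes at most half of
          what is guaranteed to \<open>C j\<close>; losing half is within the permitted factor
          \<open>d / 2\<close> because \<open>d \<le> 1\<close>.\<close>
        have "w x \<le> sum w (C j) / 2" if "x \<in> C j"
        proof -
          have "w x \<le> \<eta> * W j"
            using overlap[of k j x] kh j(2) kj C(1)[OF order_refl kh] C(1)[OF kj(2) j(2)] xC that by auto
          then show ?thesis using C\<rho>[OF kj(2) j(2)] unfolding \<eta> by simp
        qed
        then have "sum w (C j) / 2 \<le> sum w (C j - {x})"
          using sum_diff1[OF finC[OF kj(2) j(2)], of w x] sum_w_nonneg[of "C j"] by (cases "x \<in> C j") auto
        moreover have "d / 2 * sum w (C j) \<le> 1 / 2 * sum w (C j)"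
          using d sum_w_nonneg by (intro mult_right_mono) auto
        ultimately show ?thesis using False by simp
      qed
      moreover have "d / 2 * (r * (d / 2) ^ k * W j) \<le> d / 2 * sum w (C j)"
        using C(4)[OF kj(2) j(2)] d by (intro mult_left_mono) auto
      ultimately show "r * (d / 2) ^ length (xs @ [x]) * W j \<le> sum w (?C j)"
        unfolding k_def by (simp add: mult_ac)
    qed
    ultimately show ?thesis
      using Suc.prems(1) by (intro Suc.IH[of "xs @ [x]" ?C]) auto
  qed
  have "(\<rho> / 2 * \<theta>) ^ Suc n = \<rho> / 2 * \<theta> * (\<rho> / 2 * \<theta>) ^ n" by simp
  also have "\<dots> \<le> sum w good * (\<rho> / 2 * \<theta>) ^ n"
    using good \<rho>pos \<theta>(1) by (intro mult_right_mono) auto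
  also have "\<dots> \<le> (\<Sum>v\<in>good. w v * hit (is_copy E A) n (xs @ [v]))"
    unfolding sum_distrib_right using step by (intro sum_mono mult_left_mono) (auto simp: w_nonneg)
  also have "\<dots> \<le> (\<Sum>v\<in>V. w v * hit (is_copy E A) n (xs @ [v]))"
    using finV C(1)[OF order_refl kh] C\<^sub>0V[of k]
    by (intro sum_mono2) (auto simp: good_def w_nonneg hit_nonneg)
  finally show ?case by simp
qed

text \<open>The candidates for \<open>i\<close> are the light part of the class of
  \<open>\<phi> i\<close>. A class that is not clumpy leaves half of its weight there, whence the
  factor 1/2 in \<rho>. The map \<phi> only shows which classes to use; density and regularity of
  the pairs of classes supply the edges.\<close>

lemma hit_of_kept_copy:
  assumes sym: "\<And>x y. A x y \<Longrightarrow> A y x" and irrefl: "\<And>x. \<not> A x x"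
    and Esym: "\<And>i j. E i j \<Longrightarrow> E j i" and Eirrefl: "\<And>i. \<not> E i i"
    and noniso: "\<And>i. i < h \<Longrightarrow> \<exists>j<h. E i j"
    and d: "0 < d" "d \<le> 1"
    and \<rho>: "\<rho> = 1 / 2 * (d / 2) ^ h" and \<beta>: "\<beta> = \<rho> / (2 * (real h + 1))" and \<eta>: "\<eta> = \<rho> / 2"
    and \<theta>: "0 < \<theta>"
    and \<phi>: "inj_on \<phi> {..<h}" "\<And>i. i < h \<Longrightarrow> \<phi> i \<in> V"
    and kept: "\<And>i j. i < h \<Longrightarrow> j < h \<Longrightarrow> E i j \<Longrightarrow> kept d \<beta> \<eta> \<theta> F (\<phi> i) (\<phi> j)"
  shows "(\<rho> / 2 * \<theta>) ^ h \<le> hit (is_copy E A) h []"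
proof -
  let ?P = "\<lambda>i. cls F (\<phi> i)"
  \<comment> \<open>Size and non-clumpiness of a class are known only through a kept pair, so every
    \<open>i\<close> needs a neighbour.\<close>
  have big: "\<theta> \<le> sum w (?P i)" "sum w (?P i) / 2 \<le> sum w (light_part \<eta> (?P i))" if "i < h" for i
    using noniso[OF that] kept that unfolding kept_def clumpy_def by (auto simp: not_less)
  have "w x \<le> \<eta> * sum w (?P j)"
    if ij: "i < h" "j < h" "i \<noteq> j" and x: "x \<in> light_part \<eta> (?P i)" "x \<in> light_part \<eta> (?P j)" for i j x
  proof -
    \<comment> \<open>Candidate sets meet only inside a common class. It contains the distinct
      vertices \<open>\<phi> i\<close> and \<open>\<phi> j\<close>, so it is no singleton and its
      light vertices are truly light.\<close>
    have "?P i = ?P j" using x cls_mem unfolding light_part_def by blast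
    then have "\<phi> i \<in> ?P j" "\<phi> j \<in> ?P j"
      using cls_self[OF \<phi>(2)[OF ij(1)]] cls_self[OF \<phi>(2)[OF ij(2)]] by auto
    moreover have "\<phi> i \<noteq> \<phi> j" using \<phi>(1) ij by (auto dest: inj_onD)
    ultimately have "\<not> is_singleton (?P j)" by (auto simp: is_singleton_def)
    then show ?thesis using x(2) by (simp add: light_part_def)
  qed
  moreover have "d / 2 * (sum w X * sum w Y) < edge_mass X Y"
    if "i < h" "j < h" "E i j" and X: "X \<subseteq> light_part \<eta> (?P i)" "Y \<subseteq> light_part \<eta> (?P j)"
      "\<beta> * sum w (?P i) \<le> sum w X" "\<beta> * sum w (?P j) \<le> sum w Y" for i j X Y
  proof -
    \<comment> \<open>Regularity is measured against the weight of the whole class, so it passes to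
      subsets of the light parts without loss.\<close>
    have "\<not> sparse_spot d \<beta> (?P i) (?P j) X Y"
      using kept[OF that(1-3)] unfolding kept_def irregular_def by blast
    moreover have "X \<subseteq> ?P i" "Y \<subseteq> ?P j" using X(1,2) unfolding light_part_def by auto
    ultimately show ?thesis using X(3,4) unfolding sparse_spot_def by auto
  qed
  moreover have "light_part \<eta> (?P j) \<subseteq> V" for j
    using cls_subset unfolding light_part_def by blast
  ultimately show ?thesis
    using big
    by (intro hit_lower_bound[OF sym irrefl Esym Eirrefl d _ \<rho> \<beta> \<eta> \<theta>,
          where C = "\<lambda>i. light_part \<eta> (?P i)" and C\<^sub>0 = "\<lambda>i. light_part \<eta> (?P i)"
            and W = "\<lambda>i. sum w (?P i)"])
      (auto simp: is_copy_def)
qed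

end

text \<open>\<delta> is chosen before the graph, the weights and the pattern \<open>E\<close>; only
  \<epsilon> and \<open>h\<close> enter. The predicate \<open>K\<close> hides the partition and
  describes which edges survive the cleaning.\<close>

theorem weighted_removal_lemma:
  assumes \<epsilon>: "0 < \<epsilon>" "\<epsilon> < 1"
  shows "\<exists>\<delta>>0. \<forall>(V :: 'a set) w A E. weighted_graph V w \<longrightarrow> symp A \<longrightarrow> irreflp A \<longrightarrow> symp E \<longrightarrow> irreflp E \<longrightarrow>
       (\<forall>i<h. \<exists>j<h. E i j) \<longrightarrow>
       (\<exists>K. (\<Sum>(x, y) | (x, y) \<in> V \<times> V \<and> A x y \<and> \<not> K x y. w x * w y) < \<epsilon> \<and>
         (\<forall>\<phi>. inj_on \<phi> {..<h} \<longrightarrow> \<phi> ` {..<h} \<subseteq> V \<longrightarrow> (\<forall>i<h. \<forall>j<h. E i j \<longrightarrow> K (\<phi> i) (\<phi> j)) \<longrightarrow>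
            \<delta> \<le> weighted_graph.hit V w (is_copy E A) h []))"
proof -
  \<comment> \<open>\<open>lost_mass\<close> charges small classes twice, clumpy classes twice,
    sparse pairs once and irregular pairs once; at most an eighth of \<epsilon> each makes six
    eighths.\<close>
  define d where "d = \<epsilon> / 8"
  define \<rho> where "\<rho> = 1 / 2 * (d / 2) ^ h"
  define \<beta> where "\<beta> = \<rho> / (2 * (real h + 1))"
  define \<eta> where "\<eta> = \<rho> / 2"
  \<comment> \<open>Least gain of potential in one refinement while one of the two masses is still
    at least \<open>\<epsilon> / 8\<close>.\<close>
  define \<gamma> where "\<gamma> = min (d\<^sup>2 / 4 * \<beta>\<^sup>2 * (\<epsilon> / 8)) (\<epsilon> / 8 / 2)"
  have d: "0 < d" "d \<le> 1" using \<epsilon> unfolding d_def by auto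
  have pos: "0 < \<rho>" "0 < \<beta>" "0 < \<eta>" using d unfolding \<rho>_def \<beta>_def \<eta>_def by auto
  then have \<gamma>: "0 < \<gamma>" unfolding \<gamma>_def using d \<epsilon> by simp
  obtain K :: nat where "2 / \<gamma> < real K" using reals_Archimedean2 by blast
  then have K: "2 < real K * \<gamma>" using \<gamma> by (simp add: field_simps)
  define N where "N = (grow \<eta> ^^ K) 0"
  define \<theta> where "\<theta> = \<epsilon> / (8 * 2 ^ N)"
  have \<theta>: "0 < \<theta>" using \<epsilon> unfolding \<theta>_def by simp
  show ?thesis
  proof (intro exI[of _ "(\<rho> / 2 * \<theta>) ^ h"] conjI allI impI)
    show "0 < (\<rho> / 2 * \<theta>) ^ h" using pos \<theta> by simp
    fix V :: "'a set" and w and A :: "'a \<Rightarrow> 'a \<Rightarrow> bool" and E :: "nat \<Rightarrow> nat \<Rightarrow> bool"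
    assume wg: "weighted_graph V w" and A: "symp A" "irreflp A" and E: "symp E" "irreflp E"
      and noniso: "\<forall>i<h. \<exists>j<h. E i j"
    interpret weighted_graph V w A by (rule wg)
    obtain F where F: "finite F" "card F \<le> N" "irregular_mass d \<beta> F < \<epsilon> / 8" "clumpy_mass \<eta> F < \<epsilon> / 8"
      using exists_regular_family[of d \<beta> \<eta> "\<epsilon> / 8" K] d pos \<epsilon> K unfolding \<gamma>_def N_def by auto
    have "(2::real) ^ card F * \<theta> \<le> 2 ^ N * \<theta>"
      using F(2) \<theta> by (intro mult_right_mono power_increasing) auto
    also have "\<dots> = \<epsilon> / 8" unfolding \<theta>_def by simp
    finally have "(\<Sum>(x, y) | (x, y) \<in> V \<times> V \<and> A x y \<and> \<not> kept d \<beta> \<eta> \<theta> F x y. w x * w y) < \<epsilon>"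
      using lost_mass[OF F(1) d(1) \<theta>, of \<beta> \<eta>] F(3,4) \<epsilon>(1) unfolding d_def by linarith
    moreover have "(\<rho> / 2 * \<theta>) ^ h \<le> hit (is_copy E A) h []"
      if "inj_on \<phi> {..<h}" "\<phi> ` {..<h} \<subseteq> V" "\<forall>i<h. \<forall>j<h. E i j \<longrightarrow> kept d \<beta> \<eta> \<theta> F (\<phi> i) (\<phi> j)" for \<phi>
      using that A E noniso
      by (intro hit_of_kept_copy[OF _ _ _ _ _ d \<rho>_def \<beta>_def \<eta>_def \<theta>, of E \<phi> F])
        (auto dest: sympD irreflpD)
    ultimately show "\<exists>K. (\<Sum>(x, y) | (x, y) \<in> V \<times> V \<and> A x y \<and> \<not> K x y. w x * w y) < \<epsilon> \<and>
         (\<forall>\<phi>. inj_on \<phi> {..<h} \<longrightarrow> \<phi> ` {..<h} \<subseteq> V \<longrightarrow> (\<forall>i<h. \<forall>j<h. E i j \<longrightarrow> K (\<phi> i) (\<phi> j)) \<longrightarrow>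
            (\<rho> / 2 * \<theta>) ^ h \<le> hit (is_copy E A) h [])"
      by (intro exI[of _ "kept d \<beta> \<eta> \<theta> F"]) blast
  qed
qed

section \<open>The tester\<close>

primrec ask :: "(nat \<times> nat) list \<Rightarrow> algorithm \<Rightarrow> algorithm \<Rightarrow> algorithm" where
  "ask [] yes no = yes"
| "ask (p # ps) yes no = Query (fst p) (snd p) (\<lambda>b. if b then ask ps yes no else no)"

primrec draw :: "nat \<Rightarrow> nat list \<Rightarrow> (nat list \<Rightarrow> algorithm) \<Rightarrow> algorithm" where
  "draw 0 xs k = k xs"
| "draw (Suc n) xs k = Sample (\<lambda>v. draw n (xs @ [v]) k)"

text \<open>A round whose sample repeats a vertex is passed over without queries. Rejection comes
  only after distinct sampled vertices have shown every edge listed in \<open>L\<close>, so the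
  error will be one-sided.\<close>

primrec rounds :: "nat \<Rightarrow> (nat \<times> nat) list \<Rightarrow> nat \<Rightarrow> algorithm" where
  "rounds h L 0 = Output True"
| "rounds h L (Suc t) = draw h []
     (\<lambda>xs. if distinct xs then ask (map (\<lambda>(i, j). (xs ! i, xs ! j)) L) (Output False) (rounds h L t)
       else rounds h L t)"

section \<open>Legality and cost of the tester\<close>

lemma legal_mono: "legal S a \<Longrightarrow> S \<subseteq> T \<Longrightarrow> legal T a"
proof (induction arbitrary: T rule: legal.induct)
  case (3 S k)
  have "legal (insert v T) (k v)" for v
    using 3(2)[of v "insert v T"] 3(3) by blast
  then show ?case by (rule legal.intros)
next
  case (4 u S v k)
  then show ?case by (auto intro!: legal.intros)
qed (auto intro: legal.intros)

lemma legal_ask: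
  assumes "\<And>p. p \<in> set ps \<Longrightarrow> fst p \<in> S \<and> snd p \<in> S" "legal S yes" "legal S no"
  shows "legal S (ask ps yes no)"
  using assms by (induction ps) (auto intro!: legal.intros)

lemma legal_draw:
  assumes "\<And>ys. length ys = length xs + n \<Longrightarrow> legal (set ys) (k ys)"
  shows "legal (set xs) (draw n xs k)"
  using assms
proof (induction n arbitrary: xs)
  case (Suc n)
  have "legal (insert v (set xs)) (draw n (xs @ [v]) k)" for v
    using Suc.IH[of "xs @ [v]"] Suc.prems by simp
  then show ?case by (auto intro: legal.intros)
qed simp

lemma legal_rounds:
  assumes "\<And>i j. (i, j) \<in> set L \<Longrightarrow> i < h \<and> j < h"
  shows "legal {} (rounds h L t)"
proof (induction t)
  case 0
  show ?case by (simp add: legal.intros)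
next
  case (Suc t)
  have IH: "legal S (rounds h L t)" for S using legal_mono[OF Suc.IH] by simp
  have "legal (set []) (rounds h L (Suc t))"
    unfolding rounds.simps
  proof (rule legal_draw)
    fix ys :: "nat list" assume "length ys = length ([] :: nat list) + h"
    then show "legal (set ys) (if distinct ys then ask (map (\<lambda>(i, j). (ys ! i, ys ! j)) L)
      (Output False) (rounds h L t) else rounds h L t)"
      using assms IH by (auto intro!: legal_ask legal.intros)
  qed
  then show ?case by simp
qed

text \<open>Quantifying over all graphs and distributions, whether or not they form an input, makes
  the bound a property of the decision tree alone.\<close>

definition cost_le :: "algorithm \<Rightarrow> nat \<Rightarrow> bool" where
  "cost_le a q \<longleftrightarrow> (\<forall>G D. \<forall>(b, n)\<in>set_pmf (run G D a). n \<le> q)"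

lemma cost_Output: "cost_le (Output b) q"
  by (simp add: cost_le_def)

lemma cost_mono: "cost_le a q \<Longrightarrow> q \<le> q' \<Longrightarrow> cost_le a q'"
  unfolding cost_le_def by fastforce

lemma cost_Query: "(\<And>b. cost_le (k b) q) \<Longrightarrow> cost_le (Query u v k) (Suc q)"
  unfolding cost_le_def by fastforce

lemma cost_Sample: "(\<And>v. cost_le (k v) q) \<Longrightarrow> cost_le (Sample k) (Suc q)"
  unfolding cost_le_def by fastforce

lemma cost_ask:
  assumes "cost_le yes q" "cost_le no q"
  shows "cost_le (ask ps yes no) (length ps + q)"
proof (induction ps)
  case (Cons p ps)
  have "cost_le no (length ps + q)" by (rule cost_mono[OF assms(2)]) simp
  then show ?case using Cons by (auto intro!: cost_Query)
qed (simp add: assms)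

lemma cost_draw:
  assumes "\<And>ys. cost_le (k ys) q"
  shows "cost_le (draw n xs k) (n + q)"
  using assms by (induction n arbitrary: xs) (auto intro!: cost_Sample)

lemma cost_rounds: "cost_le (rounds h L t) (t * (h + length L))"
proof (induction t)
  case (Suc t)
  have "cost_le (rounds h L (Suc t)) (h + (length L + t * (h + length L)))"
    unfolding rounds.simps
  proof (rule cost_draw)
    fix ys :: "nat list"
    have "cost_le (ask (map (\<lambda>(i, j). (ys ! i, ys ! j)) L) (Output False) (rounds h L t))
      (length (map (\<lambda>(i, j). (ys ! i, ys ! j)) L) + t * (h + length L))"
      by (intro cost_ask cost_Output Suc)
    moreover have "cost_le (rounds h L t) (length L + t * (h + length L))"
      by (rule cost_mono[OF Suc]) simp
    ultimately show "cost_le (if distinct ys then ask (map (\<lambda>(i, j). (ys ! i, ys ! j)) L)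
      (Output False) (rounds h L t) else rounds h L t) (length L + t * (h + length L))"
      by simp
  qed
  then show ?case by (simp add: add.assoc)
qed (simp add: cost_Output)

section \<open>Acceptance probabilities\<close>

definition acceptance :: "nat graph \<Rightarrow> nat pmf \<Rightarrow> algorithm \<Rightarrow> real" where
  "acceptance G D a = pmf (map_pmf fst (run G D a)) True"

lemma acceptance_Output: "acceptance G D (Output b) = of_bool b"
  by (simp add: acceptance_def)

lemma fst_apsnd: "map_pmf fst (map_pmf (apsnd f) p) = map_pmf fst p"
  by (simp add: map_pmf_comp)

lemma acceptance_Query: "acceptance G D (Query u v k) = acceptance G D (k ({u, v} \<in> edges G))"
  by (simp add: acceptance_def fst_apsnd)

lemma acceptance_Sample:
  assumes "vertex_weighted G D"
  shows "acceptance G D (Sample k) = (\<Sum>v\<in>verts G. pmf D v * acceptance G D (k v))"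
proof -
  have "acceptance G D (Sample k) = (\<integral>v. acceptance G D (k v) \<partial>measure_pmf D)"
    by (simp add: acceptance_def map_bind_pmf fst_apsnd pmf_bind)
  also have "\<dots> = (\<Sum>v\<in>verts G. acceptance G D (k v) * pmf D v)"
    using assms by (intro integral_measure_pmf_real)
      (auto simp: vertex_weighted_def simple_graph_def)
  finally show ?thesis by (simp add: mult.commute)
qed

lemma acceptance_ask: "acceptance G D (ask ps yes no) =
    (if \<forall>p\<in>set ps. {fst p, snd p} \<in> edges G then acceptance G D yes else acceptance G D no)"
  by (induction ps) (auto simp: acceptance_Query)

lemma weighted_graph_pmf:
  assumes "vertex_weighted G D"
  shows "weighted_graph (verts G) (pmf D)"
  using assms unfolding vertex_weighted_def simple_graph_def
  by unfold_locales (auto intro: sum_pmf_eq_1)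

lemma acceptance_draw:
  assumes GD: "vertex_weighted G D"
    and k: "\<And>ys. length ys = length xs + n \<Longrightarrow> acceptance G D (k ys) = (if c ys then 0 else s)"
  shows "acceptance G D (draw n xs k) = (1 - weighted_graph.hit (verts G) (pmf D) c n xs) * s"
proof -
  interpret weighted_graph "verts G" "pmf D" by (rule weighted_graph_pmf[OF GD])
  show ?thesis
    using k
  proof (induction n arbitrary: xs)
    case (Suc n)
    have "acceptance G D (draw (Suc n) xs k)
        = (\<Sum>v\<in>verts G. pmf D v * acceptance G D (draw n (xs @ [v]) k))"
      by (simp add: acceptance_Sample[OF GD])
    also have "\<dots> = (\<Sum>v\<in>verts G. pmf D v * ((1 - hit c n (xs @ [v])) * s))"
      using Suc by (intro sum.cong) auto
    also have "\<dots> = (\<Sum>v\<in>verts G. pmf D v * s - pmf D v * hit c n (xs @ [v]) * s)"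
      by (intro sum.cong) (auto simp: algebra_simps)
    also have "\<dots> = (1 - hit c (Suc n) xs) * s"
      by (simp only: sum_subtractf sum_distrib_right[symmetric] sum_w hit.simps left_diff_distrib mult_1)
    finally show ?case .
  qed simp
qed

text \<open>Acceptance means that every round misses; the rounds draw fresh samples, so their
  probabilities multiply.\<close>

lemma acceptance_rounds:
  assumes GD: "vertex_weighted G D"
    and L: "\<And>i j. (i, j) \<in> set L \<longleftrightarrow> i < h \<and> j < h \<and> E i j"
  shows "acceptance G D (rounds h L t) =
    (1 - weighted_graph.hit (verts G) (pmf D) (is_copy E (\<lambda>x y. {x, y} \<in> edges G)) h []) ^ t"
proof (induction t)
  case (Suc t)
  have "acceptance G D (rounds h L (Suc t)) =
    (1 - weighted_graph.hit (verts G) (pmf D) (is_copy E (\<lambda>x y. {x, y} \<in> edges G)) h [])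
    * acceptance G D (rounds h L t)"
    unfolding rounds.simps
  proof (rule acceptance_draw[OF GD])
    fix ys :: "nat list" assume "length ys = length ([] :: nat list) + h"
    then have "(\<forall>p\<in>set (map (\<lambda>(i, j). (ys ! i, ys ! j)) L). {fst p, snd p} \<in> edges G) \<longleftrightarrow>
      (\<forall>i<length ys. \<forall>j<length ys. E i j \<longrightarrow> {ys ! i, ys ! j} \<in> edges G)"
      using L by (fastforce simp: case_prod_unfold)
    then have "is_copy E (\<lambda>x y. {x, y} \<in> edges G) ys \<longleftrightarrow> distinct ys \<and>
      (\<forall>p\<in>set (map (\<lambda>(i, j). (ys ! i, ys ! j)) L). {fst p, snd p} \<in> edges G)"
      by (simp only: is_copy_def)
    then show "acceptance G D (if distinct ys then ask (map (\<lambda>(i, j). (ys ! i, ys ! j)) L)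
        (Output False) (rounds h L t) else rounds h L t) =
      (if is_copy E (\<lambda>x y. {x, y} \<in> edges G) ys then 0 else acceptance G D (rounds h L t))"
      by (simp only: if_distrib[of "acceptance G D"] acceptance_ask acceptance_Output) simp
  qed
  then show ?case by (simp add: Suc)
qed (simp add: acceptance_Output)

section \<open>Copies of an indexed graph\<close>

text \<open>\<open>H\<close> moved to an initial segment of the naturals along the enumeration
  \<open>b\<close>; the bounds are explicit because \<open>b\<close> may take any value outside that
  segment.\<close>

definition index_edge :: "(nat \<Rightarrow> 'a) \<Rightarrow> 'a graph \<Rightarrow> nat \<Rightarrow> nat \<Rightarrow> bool" where
  "index_edge b H i j \<longleftrightarrow> i < card (verts H) \<and> j < card (verts H) \<and> {b i, b j} \<in> edges H"

lemma simple_graph_edgeE: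
  assumes "simple_graph G" "e \<in> edges G"
  obtains x y where "e = {x, y}" "x \<noteq> y" "x \<in> verts G" "y \<in> verts G"
  using assms unfolding simple_graph_def by (metis card_2_iff insert_subset)

lemma not_edge_refl: "simple_graph G \<Longrightarrow> {x, x} \<notin> edges G"
  unfolding simple_graph_def by auto

lemma H_free_no_copy:
  assumes H: "simple_graph H" and b: "bij_betw b {..<card (verts H)} (verts H)"
    and G: "G \<in> H_free H"
    and xs: "set xs \<subseteq> verts G" "length xs = card (verts H)"
  shows "\<not> is_copy (index_edge b H) (\<lambda>x y. {x, y} \<in> edges G) xs"
proof
  assume copy: "is_copy (index_edge b H) (\<lambda>x y. {x, y} \<in> edges G) xs"
  let ?h = "card (verts H)"
  define f where "f v = xs ! (inv_into {..<?h} b v)" for v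
  let ?S = "(f ` verts H, (\<lambda>e. f ` e) ` edges H)"
  have nth: "bij_betw ((!) xs) {..<?h} (set xs)"
    using copy xs(2) by (intro bij_betw_nth) (auto simp: is_copy_def)
  have "bij_betw ((!) xs \<circ> inv_into {..<?h} b) (verts H) (set xs)"
    using bij_betw_trans[OF bij_betw_inv_into[OF b] nth] .
  then have f: "bij_betw f (verts H) (set xs)" by (simp add: f_def[abs_def] comp_def)
  have inj: "inj_on f (verts H)" and im: "f ` verts H = set xs" using f by (auto simp: bij_betw_def)
  have fe: "f ` e \<in> edges G \<and> f ` e \<subseteq> f ` verts H \<and> card (f ` e) = 2" if e: "e \<in> edges H" for e
  proof -
    obtain x y where xy: "e = {x, y}" "x \<noteq> y" "x \<in> verts H" "y \<in> verts H"
      by (rule simple_graph_edgeE[OF H e])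
    let ?i = "inv_into {..<?h} b x" and ?j = "inv_into {..<?h} b y"
    have "?i < ?h" "?j < ?h" "b ?i = x" "b ?j = y"
      using xy b bij_betw_inv_into[OF b] by (auto simp: bij_betw_inv_into_right bij_betw_def)
    then have "{xs ! ?i, xs ! ?j} \<in> edges G"
      using copy e xy(1) xs(2) unfolding is_copy_def index_edge_def by auto
    moreover have "f x \<noteq> f y" using inj xy by (auto dest: inj_onD)
    ultimately show ?thesis using xy by (auto simp: f_def)
  qed
  have "simple_graph ?S"
    using fe H unfolding simple_graph_def by auto
  then have "subgraph ?S G"
    using fe im xs(1) unfolding subgraph_def by auto
  moreover have "isomorphic H ?S"
    using inj unfolding isomorphic_def by (intro exI[of _ f]) (simp add: bij_betw_def)
  then have "isomorphic ?S H" by (rule isomorphic_sym[OF H])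
  ultimately show False using G unfolding H_free_def by blast
qed

lemma copy_of_not_H_free:
  assumes H: "simple_graph H" and b: "bij_betw b {..<card (verts H)} (verts H)"
    and G: "simple_graph G" "G \<notin> H_free H"
  obtains \<phi> where "inj_on \<phi> {..<card (verts H)}" "\<phi> ` {..<card (verts H)} \<subseteq> verts G"
    "\<And>i j. index_edge b H i j \<Longrightarrow> {\<phi> i, \<phi> j} \<in> edges G"
proof -
  obtain S where S: "subgraph S G" "isomorphic S H"
    using G unfolding H_free_def by blast
  then have "isomorphic H S" using isomorphic_sym unfolding subgraph_def by blast
  then obtain f where f: "bij_betw f (verts H) (verts S)" "edges S = (\<lambda>e. f ` e) ` edges H"
    unfolding isomorphic_def by blast
  have fb: "bij_betw (f \<circ> b) {..<card (verts H)} (verts S)"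
    using bij_betw_trans[OF b f(1)] .
  show ?thesis
  proof (rule that[of "f \<circ> b"])
    show "inj_on (f \<circ> b) {..<card (verts H)}" using fb by (simp add: bij_betw_def)
    show "(f \<circ> b) ` {..<card (verts H)} \<subseteq> verts G"
      using fb S(1) by (auto simp: bij_betw_def subgraph_def)
    fix i j assume "index_edge b H i j"
    then have "f ` {b i, b j} \<in> edges S" unfolding f(2) index_edge_def by blast
    then show "{(f \<circ> b) i, (f \<circ> b) j} \<in> edges G" using S(1) by (auto simp: subgraph_def)
  qed
qed

text \<open>An edge survives only if \<open>K\<close> holds in both orientations, so
  \<open>K\<close> need not be symmetric. A deleted edge has a failing orientation and is therefore
  charged at least once in the sum over ordered pairs.\<close>

lemma graph_dist_filter_le:
  assumes G: "simple_graph G"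
    and E': "E' = {e \<in> edges G. \<forall>x y. e = {x, y} \<longrightarrow> K x y}"
  shows "graph_dist D G (verts G, E') \<le>
    (\<Sum>(x, y) | (x, y) \<in> verts G \<times> verts G \<and> {x, y} \<in> edges G \<and> \<not> K x y. pmf D x * pmf D y)"
proof -
  let ?B = "{(x, y). (x, y) \<in> verts G \<times> verts G \<and> {x, y} \<in> edges G \<and> \<not> K x y}"
  let ?p = "\<lambda>(x, y). {x, y}"
  have fin: "finite ?B"
    using G by (intro finite_subset[of ?B "verts G \<times> verts G"]) (auto simp: simple_graph_def)
  have "sym_diff (edges G) E' = ?p ` ?B"
  proof -
    have "e \<in> ?p ` ?B" if "e \<in> edges G" "e = {x, y}" "\<not> K x y" for e x y
      using that G unfolding simple_graph_def by (intro image_eqI[of _ _ "(x, y)"]) auto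
    then show ?thesis unfolding E' by fastforce
  qed
  then have "graph_dist D G (verts G, E') = (\<Sum>e\<in>?p ` ?B. \<Prod>x\<in>e. pmf D x)"
    by (simp add: graph_dist_def)
  also have "\<dots> \<le> (\<Sum>q\<in>?B. \<Prod>x\<in>?p q. pmf D x)"
    using sum_image_le[OF fin, of "\<lambda>e. \<Prod>x\<in>e. pmf D x" ?p] by (simp add: prod_nonneg comp_def)
  also have "\<dots> = (\<Sum>(x, y)\<in>?B. pmf D x * pmf D y)"
  proof (rule sum.cong)
    fix q assume "q \<in> ?B"
    moreover obtain x y where q: "q = (x, y)" by (cases q)
    ultimately have "x \<noteq> y" using not_edge_refl[OF G, of x] by auto
    then show "(\<Prod>x\<in>?p q. pmf D x) = (case q of (x, y) \<Rightarrow> pmf D x * pmf D y)" by (simp add: q)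
  qed simp
  finally show ?thesis .
qed

text \<open>Each round finds a copy in a far graph with probability at least
  \<open>\<delta> \<epsilon>\<close>, so enough rounds push the chance of missing all of them below
  1/3. An \<open>H\<close>-free graph is accepted with probability 1.\<close>

lemma testable_if_no_isolated:
  assumes H: "simple_graph H" and noniso: "\<And>v. \<not> isolated H v"
  shows "vdf_testable (H_free H)"
proof -
  let ?h = "card (verts H)"
  have "finite (verts H)" using H by (simp add: simple_graph_def)
  then obtain b where b: "bij_betw b {..<?h} (verts H)"
    using ex_bij_betw_nat_finite atLeast0LessThan by metis
  define E where "E = index_edge b H"
  have Esym: "E i j \<Longrightarrow> E j i" for i j by (simp add: E_def index_edge_def insert_commute)
  have Eirrefl: "\<not> E i i" for i using not_edge_refl[OF H] by (simp add: E_def index_edge_def)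
  have Enoniso: "\<exists>j<?h. E i j" if i: "i < ?h" for i
  proof -
    have "b i \<in> verts H" using b i by (auto simp: bij_betw_def)
    then obtain e where e: "e \<in> edges H" "b i \<in> e" using noniso unfolding isolated_def by blast
    obtain x y where "e = {x, y}" "x \<in> verts H" "y \<in> verts H" by (rule simple_graph_edgeE[OF H e(1)])
    then obtain z where "e = {b i, z}" "z \<in> verts H" using e(2) by auto
    moreover then obtain j where "j < ?h" "z = b j" using b by (auto simp: bij_betw_def)
    ultimately show ?thesis using e i by (auto simp: E_def index_edge_def)
  qed
  define L where "L = filter (\<lambda>(i, j). E i j) (List.product [0..<?h] [0..<?h])"
  have L: "(i, j) \<in> set L \<longleftrightarrow> i < ?h \<and> j < ?h \<and> E i j" for i j by (auto simp: L_def)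
  let ?hit = "\<lambda>G D. weighted_graph.hit (verts G) (pmf D) (is_copy E (\<lambda>x y. {x, y} \<in> edges G)) ?h []"
  have "\<exists>\<delta>>0. \<forall>G D. vertex_weighted G D \<longrightarrow> far \<epsilon> G D (H_free H) \<longrightarrow> \<delta> \<le> ?hit G D"
    if \<epsilon>: "0 < \<epsilon>" "\<epsilon> < 1" for \<epsilon>
  proof -
    obtain \<delta> where \<delta>: "0 < \<delta>"
      "\<And>V w A E. weighted_graph V w \<Longrightarrow> symp A \<Longrightarrow> irreflp (A :: nat \<Rightarrow> nat \<Rightarrow> bool) \<Longrightarrow> symp E \<Longrightarrow> irreflp E \<Longrightarrow>
       \<forall>i<?h. \<exists>j<?h. E i j \<Longrightarrow>
       \<exists>K. (\<Sum>(x, y) | (x, y) \<in> V \<times> V \<and> A x y \<and> \<not> K x y. w x * w y) < \<epsilon> \<and>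
         (\<forall>\<phi>. inj_on \<phi> {..<?h} \<longrightarrow> \<phi> ` {..<?h} \<subseteq> V \<longrightarrow> (\<forall>i<?h. \<forall>j<?h. E i j \<longrightarrow> K (\<phi> i) (\<phi> j)) \<longrightarrow>
            \<delta> \<le> weighted_graph.hit V w (is_copy E A) ?h [])"
      using weighted_removal_lemma[OF \<epsilon>, where h = ?h and 'a = nat] by blast

    have "\<delta> \<le> ?hit G D" if GD: "vertex_weighted G D" and far: "far \<epsilon> G D (H_free H)" for G D
    proof -
      have G: "simple_graph G" using GD by (simp add: vertex_weighted_def)
      obtain K where K:
        "(\<Sum>(x, y) | (x, y) \<in> verts G \<times> verts G \<and> {x, y} \<in> edges G \<and> \<not> K x y. pmf D x * pmf D y) < \<epsilon>"
        "\<And>\<phi>. inj_on \<phi> {..<?h} \<Longrightarrow> \<phi> ` {..<?h} \<subseteq> verts G \<Longrightarrow> (\<forall>i<?h. \<forall>j<?h. E i j \<longrightarrow> K (\<phi> i) (\<phi> j)) \<Longrightarrow>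
            \<delta> \<le> ?hit G D"
        using \<delta>(2)[OF weighted_graph_pmf[OF GD], of "\<lambda>x y. {x, y} \<in> edges G" E]
          Esym Eirrefl Enoniso not_edge_refl[OF G]
        by (auto simp: insert_commute symp_def irreflp_def)
      define E' where "E' = {e \<in> edges G. \<forall>x y. e = {x, y} \<longrightarrow> K x y}"
      \<comment> \<open>The cleaned graph is closer than \<epsilon>, so farness forces a copy of
        \<open>H\<close> in it; the edges of that copy satisfy \<open>K\<close>, and the removal
        lemma turns this one copy into a positive probability.\<close>
      have "graph_dist D G (verts G, E') < \<epsilon>"
        using graph_dist_filter_le[OF G E'_def, of D] K(1) by linarith
      then have "(verts G, E') \<notin> H_free H" using far unfolding far_def by fastforce
      moreover have "simple_graph (verts G, E')" using G unfolding simple_graph_def E'_def by auto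
      ultimately obtain \<phi> where \<phi>: "inj_on \<phi> {..<?h}" "\<phi> ` {..<?h} \<subseteq> verts (verts G, E')"
        "\<And>i j. index_edge b H i j \<Longrightarrow> {\<phi> i, \<phi> j} \<in> edges (verts G, E')"
        using copy_of_not_H_free[OF H b] by metis
      have "K (\<phi> i) (\<phi> j)" if "E i j" for i j
        using \<phi>(3)[OF that[unfolded E_def]] unfolding E'_def by auto
      then show ?thesis using \<phi>(1,2) by (intro K(2)) auto
    qed
    then show ?thesis using \<delta>(1) by blast
  qed
  then obtain \<delta> where \<delta>: "\<And>\<epsilon>. 0 < \<epsilon> \<Longrightarrow> \<epsilon> < 1 \<Longrightarrow> 0 < (\<delta> \<epsilon> :: real)"
    "\<And>\<epsilon> G D. 0 < \<epsilon> \<Longrightarrow> \<epsilon> < 1 \<Longrightarrow> vertex_weighted G D \<Longrightarrow> far \<epsilon> G D (H_free H) \<Longrightarrow> \<delta> \<epsilon> \<le> ?hit G D"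
    by metis
  have "\<exists>t. (1 - \<delta> \<epsilon>) ^ t < 1 / 3" if "0 < \<epsilon>" "\<epsilon> < 1" for \<epsilon>
    using \<delta>(1)[OF that] by (intro real_arch_pow_inv) auto
  then obtain t where t: "\<And>\<epsilon>. 0 < \<epsilon> \<Longrightarrow> \<epsilon> < 1 \<Longrightarrow> (1 - \<delta> \<epsilon>) ^ t \<epsilon> < 1 / 3" by metis
  define T where "T \<epsilon> = rounds ?h L (t \<epsilon>)" for \<epsilon>
  have acc: "pmf (map_pmf fst (run G D (T \<epsilon>))) True = (1 - ?hit G D) ^ t \<epsilon>"
    if "vertex_weighted G D" for G D \<epsilon>
    using acceptance_rounds[OF that L] unfolding acceptance_def T_def by simp
  have "vdf_tester T (H_free H)"
    unfolding vdf_tester_def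
  proof (intro allI impI conjI)
    fix \<epsilon> :: real assume \<epsilon>: "0 < \<epsilon> \<and> \<epsilon> < 1"
    show "legal {} (T \<epsilon>)" unfolding T_def using L by (intro legal_rounds) auto
    fix G D assume GD: "vertex_weighted G D"
    interpret weighted_graph "verts G" "pmf D" by (rule weighted_graph_pmf[OF GD])
    show "2 / 3 \<le> pmf (map_pmf fst (run G D (T \<epsilon>))) True" if "G \<in> H_free H"
    proof -
      have "?hit G D = 0"
        using H_free_no_copy[OF H b that] by (intro hit_eq_0) (auto simp: E_def)
      then show ?thesis by (simp add: acc[OF GD])
    qed
    show "2 / 3 \<le> pmf (map_pmf fst (run G D (T \<epsilon>))) False" if far: "far \<epsilon> G D (H_free H)"
    proof -
      have "(1 - ?hit G D) ^ t \<epsilon> \<le> (1 - \<delta> \<epsilon>) ^ t \<epsilon>"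
        using \<delta>(2)[OF _ _ GD far] \<epsilon> hit_le_1 by (intro power_mono) auto
      then show ?thesis
        using t[of \<epsilon>] \<epsilon> unfolding pmf_False_conv_True acc[OF GD] by auto
    qed
  qed
  moreover have "\<forall>(b, n)\<in>set_pmf (run G D (T \<epsilon>)). n \<le> t \<epsilon> * (?h + length L)" for \<epsilon> G D
    using cost_rounds[of ?h L "t \<epsilon>"] unfolding cost_le_def T_def by blast
  ultimately show ?thesis
    unfolding vdf_testable_def
    by (intro exI[of _ "\<lambda>\<epsilon>. t \<epsilon> * (?h + length L)"] exI[of _ T]) blast
qed

section \<open>Isolated vertices\<close>

definition complete_edges :: "nat \<Rightarrow> nat set set" where
  "complete_edges n = {e. e \<subseteq> {..<n} \<and> card e = 2}"

text \<open>\<open>run\<close> consults the distribution and the edge set but never the vertex set,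
  so a weightless vertex without edges leaves no trace.\<close>

lemma run_edges_cong: "edges G = edges G' \<Longrightarrow> run G D a = run G' D a"
proof (induction a)
  case (Coin p)
  then have "map_pmf (run G D) p = map_pmf (run G' D) p" by (intro map_pmf_cong) auto
  then show ?case by simp
next
  case (Sample k)
  then show ?case by simp
next
  case (Query u v k)
  then show ?case by simp
qed simp

text \<open>The complete graph on \<open>card (verts H) - 1\<close> vertices is too small to contain \<open>H\<close>, but after
  adding a vertex of weight zero it contains \<open>H\<close> robustly, and no algorithm sees that vertex.\<close>

lemma not_testable_if_isolated:
  assumes H: "simple_graph H" and iso: "isolated H v" and card: "card (verts H) \<noteq> 1"
  shows "\<not> vdf_testable (H_free H)"
proof
  assume "vdf_testable (H_free H)"
  then obtain T where T: "vdf_tester T (H_free H)" unfolding vdf_testable_def by blast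
  have finH: "finite (verts H)" using H by (simp add: simple_graph_def)
  have vH: "v \<in> verts H" using iso by (simp add: isolated_def)
  define n where "n = card (verts H) - 1"
  have "card (verts H) \<noteq> 0" using finH vH by auto
  \<comment> \<open>\<open>H\<close> has a vertex besides \<open>v\<close>, so \<open>n\<close> is
    positive and there is a uniform distribution on \<open>{..<n}\<close>.\<close>
  then have n: "0 < n" "card (verts H) = Suc n" using card unfolding n_def by auto
  define D where "D = pmf_of_set {..<n}"
  let ?G = "({..<n}, complete_edges n)" and ?G' = "({..n}, complete_edges n)"
  \<comment> \<open>Deleting one edge of the clique costs \<open>1 / (real n)\<^sup>2\<close>. The
    factor 2 keeps the parameter below 1 also for \<open>n = 1\<close>, where \<open>H\<close> has
    no edge and no graph on the two vertices is \<open>H\<close>-free.\<close>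
  let ?\<epsilon> = "1 / (2 * (real n)\<^sup>2)"
  have setD: "set_pmf D = {..<n}" unfolding D_def using n by (intro set_pmf_of_set) auto
  have pmfD: "pmf D x = 1 / real n" if "x < n" for x
    unfolding D_def using n that by (subst pmf_of_set) auto
  have sG: "simple_graph ?G" "simple_graph ?G'"
    by (auto simp: simple_graph_def complete_edges_def)
  have GD: "vertex_weighted ?G D" "vertex_weighted ?G' D"
    using sG setD by (simp_all add: vertex_weighted_def subset_eq)
  have G: "?G \<in> H_free H"
  proof -
    have False if S: "subgraph S ?G" "isomorphic S H" for S
    proof -
      have "card (verts S) = Suc n"
        using S(2) n(2) bij_betw_same_card unfolding isomorphic_def by metis
      moreover have "card (verts S) \<le> n"
        using S(1) card_mono[of "{..<n}" "verts S"] unfolding subgraph_def by simp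
      ultimately show False by simp
    qed
    then show ?thesis using sG(1) unfolding H_free_def by blast
  qed
  have far: "far ?\<epsilon> ?G' D (H_free H)"
    unfolding far_def
  proof (intro ballI impI)
    fix G' assume G': "G' \<in> H_free H" "verts G' = verts ?G'"
    have sG': "simple_graph G'" using G' by (simp add: H_free_def)
    have "\<not> complete_edges n \<subseteq> edges G'"
    proof
      assume sub: "complete_edges n \<subseteq> edges G'"
      have "card (verts H - {v}) = card {..<n}" using n(2) vH finH by simp
      then obtain f where f: "bij_betw f (verts H - {v}) {..<n}"
        using finite_same_card_bij[of "verts H - {v}" "{..<n}"] finH by auto
      \<comment> \<open>\<open>v\<close> goes to the weightless vertex \<open>n\<close>, the other
        vertices onto the clique; \<open>v\<close> lies on no edge, so every edge of
        \<open>H\<close> lands inside the clique.\<close>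
      define g where "g = f(v := n)"
      have g: "bij_betw g (verts H) {..n}"
      proof -
        have "bij_betw g (verts H - {v}) {..<n}"
          using f by (rule bij_betw_cong[THEN iffD1, rotated]) (simp add: g_def)
        then have "bij_betw g (verts H - {v} \<union> {v}) ({..<n} \<union> {n})"
          by (rule bij_betw_combine) (auto simp: g_def bij_betw_def)
        moreover have "verts H - {v} \<union> {v} = verts H" "{..<n} \<union> {n} = {..n}" using vH by auto
        ultimately show ?thesis by simp
      qed
      have ge: "g ` e \<in> complete_edges n" if e: "e \<in> edges H" for e
      proof -
        have ev: "e \<subseteq> verts H - {v}" "card e = 2"
          using e H iso unfolding simple_graph_def isolated_def by auto
        have "card (g ` e) = 2"
          using ev g card_image[of g e] inj_on_subset[of g "verts H" e] by (auto simp: bij_betw_def)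
        moreover have "g ` e = f ` e" using ev by (auto simp: g_def)
        ultimately show ?thesis using ev f unfolding complete_edges_def bij_betw_def by auto
      qed
      let ?S = "({..n}, (\<lambda>e. g ` e) ` edges H)"
      have "simple_graph ?S"
        using ge unfolding simple_graph_def complete_edges_def by (auto; fastforce)
      then have "subgraph ?S G'" using sub ge G'(2) unfolding subgraph_def by auto
      moreover have "isomorphic H ?S" using g unfolding isomorphic_def by auto
      then have "isomorphic ?S H" by (rule isomorphic_sym[OF H])
      ultimately show False using G'(1) unfolding H_free_def by blast
    qed
    then obtain e where e: "e \<in> complete_edges n" "e \<notin> edges G'" by blast
    have fin: "finite (sym_diff (edges ?G') (edges G'))"
    proof (rule finite_subset)
      show "sym_diff (edges ?G') (edges G') \<subseteq> Pow {..n}"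
        using sG' sG(2) G'(2) unfolding simple_graph_def by auto
    qed simp
    have "(\<Prod>x\<in>e. pmf D x) = (\<Prod>x\<in>e. 1 / real n)"
      using e(1) by (intro prod.cong) (auto simp: complete_edges_def pmfD)
    also have "\<dots> = 1 / (real n)\<^sup>2"
      using e(1) by (simp add: complete_edges_def power_one_over)
    finally have "1 / (real n)\<^sup>2 \<le> graph_dist D ?G' G'"
      using member_le_sum[of e "sym_diff (edges ?G') (edges G')" "\<lambda>e. \<Prod>x\<in>e. pmf D x"] fin e
      unfolding graph_dist_def by (auto simp: prod_nonneg)
    moreover have "?\<epsilon> \<le> 1 / (real n)\<^sup>2" using n(1) by (intro divide_left_mono) auto
    ultimately show "?\<epsilon> \<le> graph_dist D ?G' G'" by linarith
  qed
  have "1 \<le> (real n)\<^sup>2" using n(1) by simp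
  then have "1 < 2 * (real n)\<^sup>2" by linarith
  then have \<epsilon>: "0 < ?\<epsilon>" "?\<epsilon> < 1" using n(1) by simp_all
  have "run ?G D (T ?\<epsilon>) = run ?G' D (T ?\<epsilon>)" by (rule run_edges_cong) simp
  moreover have "pmf (map_pmf fst (run ?G D (T ?\<epsilon>))) True \<ge> 2/3"
    using T GD(1) G \<epsilon> unfolding vdf_tester_def by blast
  moreover have "pmf (map_pmf fst (run ?G' D (T ?\<epsilon>))) False \<ge> 2/3"
    using T GD(2) far \<epsilon> unfolding vdf_tester_def by blast
  ultimately show False unfolding pmf_False_conv_True by simp
qed

theorem corollary3:
  fixes H :: "'a graph"
  assumes "simple_graph H"
    and "card (verts H) \<noteq> 1"
  shows "vdf_testable (H_free H) \<longleftrightarrow> \<not> (\<exists>v. isolated H v)"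
  using testable_if_no_isolated[OF assms(1)] not_testable_if_isolated[OF assms(1) _ assms(2)] by blast

end
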